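(* Let $p\ge 2$ be a prime, let $n\ge 3$, and let $\mathcal C=\underline{(\mathbb Z/p^{2n})\text{-mod}}$ be the classical stable category, endowed with the shift automorphism described in the context. Let $X$ and $\tilde X$ be the periodic $n$-pretriangles in $\mathcal C$ described in the context. Then $X$ is not isomorphic to $\tilde X$ in $\mathcal C^{+,\mathrm{periodic}}(\bar\Delta_n^\#)$.
   Context: Conventions. Matrices act on row vectors, so the entry in row $r$, column $s$ is the component from the $r$-th summand to the $s$-th summand. Posets. For $n\ge 0$ let $\bar\Delta_n$ be the linearly ordered set of symbols $i^{+z}$ ($0\le i\le n$, $z\in\mathbb Z$), with $i^{+z}\le j^{+w}$ iff $z<w$, or $z=w$ and $i\le j$; write $i$ for $i^{+0}$ and $(i^{+z})^{+w}=i^{+(z+w)}$, $\alpha^{-1}=\alpha^{+(-1)}$. Let $\bar\Delta_n^\#$ be the poset of pairs $\beta/\alpha$ with $\alpha,\beta\in\bar\Delta_n$, $\beta^{-1}\le\alpha\le\beta\le\alpha^{+1}$, ordered componentwise, with shift $(\beta/\alpha)^{+1}=\alpha^{+1}/\beta$. Let $\bar\Delta_n^{\triangle\triangledown}=\{\beta/\alpha\in\bar\Delta_n^\#:0\le\alpha\le\beta\le 0^{+1}\}$. Pretriangles. Let $\mathcal C$ be a weakly abelian category (additive; every morphism has a weak kernel and a weak cokernel, is a weak kernel and is a weak cokernel) with an automorphism $X\mapsto X^{+1}$ (shift). A weak square is a commutative quadrangle $A\to B$, $A\to C$, $B\to D$, $C\to D$ such that in the sequence $A\to B\oplus C\to D$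 (one sign inserted) the first morphism is a weak kernel of the second and the second a weak cokernel of the first. $\mathcal C^+(\bar\Delta_n^\#)$ is the full subcategory of the category of functors $X:\bar\Delta_n^\#\to\mathcal C$ such that $X_{\alpha/\alpha}$ and $X_{\alpha^{+1}/\alpha}$ are zero for all $\alpha$, and such that for $\delta^{-1}\le\alpha\le\beta\le\gamma\le\delta\le\alpha^{+1}$ the quadrangle $(X_{\gamma/\alpha},X_{\delta/\alpha},X_{\gamma/\beta},X_{\delta/\beta})$ is a weak square. Its objects are $n$-pretriangles. For such $X$ put $([X]^{+1})_{\beta/\alpha}=X_{(\beta/\alpha)^{+1}}$ and $[X^{+1}]_{\beta/\alpha}=(X_{\beta/\alpha})^{+1}$; likewise for morphisms. $X$ is periodic if $[X]^{+1}=[X^{+1}]$; $\mathcal C^{+,\mathrm{periodic}}(\bar\Delta_n^\#)$ has as objects the periodic $n$-pretriangles and as morphisms those $f$ with $[f]^{+1}=[f^{+1}]$. Thus a periodic morphism is given by a morphism between the restrictions to $\bar\Delta_n^{\triangle\triangledown}$ whose entry at $0^{+1}/i$ is the shift of its entry at $i/0$ for $1\le i\le n$. The category. Let $m=2n$. Objects of $\mathcal E=(\mathbb Z/p^m)\text{-mod}$ are the modules $\bigoplus_{i=0}^m(\mathbb Z/p^i)^{\oplus a_i}$, one for each tuple $(a_i)_{0\le i\le m}$ of nonnegative integers; morphisms are $\mathbb Z/p^m$-linear maps. $\mathcal E$ is an abelian Frobenius category; its bijective (i.e. projective and injective) objects are those isomorphic to finite direct sums of copies of $\mathbb Z/p^m$.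 $\mathcal C=\underline{\mathcal E}$ is the quotient of $\mathcal E$ by the bijective objects. The shift automorphism of $\mathcal C$ is induced by the short exact sequences $\mathbb Z/p^i\xrightarrow{p^{m-i}}\mathbb Z/p^m\xrightarrow{1}\mathbb Z/p^{m-i}$ and their direct sums (the list of cyclic summands of an object is reversed on shifting): on indecomposables $(\mathbb Z/p^i\xrightarrow{a}\mathbb Z/p^j)^{+1}=(\mathbb Z/p^{m-i}\xrightarrow{p^{i-j}a}\mathbb Z/p^{m-j})$, extended to matrices with the order of summands reversed. The morphism $\mathbb Z/p^i\xrightarrow{a}\mathbb Z/p^j$ is zero in $\mathcal C$ iff $p^{\min(m-i,j)}$ divides $a$. The diagrams. A periodic $n$-pretriangle is specified by its restriction to $\bar\Delta_n^{\triangle\triangledown}$. $X$ has $X_{j/0}=\mathbb Z/p^n$ ($1\le j\le n$), $X_{0^{+1}/i}=\mathbb Z/p^n$ ($1\le i\le n$), $X_{j/i}=\mathbb Z/p^{j-i}\oplus\mathbb Z/p^{2n-j+i}$ ($1\le i<j\le n$), and zero at $\alpha/\alpha$ and at $0^{+1}/0$. Its morphisms are - $j/0\to(j+1)/0$: $p$ ($1\le j<n$); - $j/0\to j/1$: $(1\;\;p^{n-j+1})$ ($2\le j\le n$); - $j/i\to(j+1)/i$: $\left(\begin{smallmatrix}p&0\\0&1\end{smallmatrix}\right)$ ($1\le i<j<n$); - $j/i\to j/(i+1)$: $\left(\begin{smallmatrix}1&0\\0&p\end{smallmatrix}\right)$ ($1\le i$, $i+1<j\le n$); - $n/i\to 0^{+1}/i$: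 $\left(\begin{smallmatrix}-p^i\\1\end{smallmatrix}\right)$ ($1\le i\le n-1$); - $0^{+1}/i\to 0^{+1}/(i+1)$: $p$ ($1\le i<n$). $\tilde X$ has the same objects and morphisms, except that $(n-1)/1\to n/1$ is $\left(\begin{smallmatrix} p & 0 \\ p^{n-3} & 1 \end{smallmatrix}\right)$ and $n/1\to n/2$ is $\left(\begin{smallmatrix} 1 & 0 \\ -p^{n-3} & p \end{smallmatrix}\right)$. Both $X$ and $\tilde X$ are periodic $n$-pretriangles in $\mathcal C$. *)

theory Defs
  imports "HOL-Algebra.Module" "HOL-Number_Theory.Residues"
begin

section \<open>Categories\<close>

text \<open>
  Composition is written in diagrammatic order: \<open>Comp C x y z f g\<close> is \<open>f : x \<rightarrow> y\<close> followed by
  \<open>g : y \<rightarrow> z\<close>. Hom-sets need not be disjoint, so the objects are passed along.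
\<close>

record ('o, 'm) category =
  Ob :: "'o set"
  Hom :: "'o \<Rightarrow> 'o \<Rightarrow> 'm set"
  Id :: "'o \<Rightarrow> 'm"
  Comp :: "'o \<Rightarrow> 'o \<Rightarrow> 'o \<Rightarrow> 'm \<Rightarrow> 'm \<Rightarrow> 'm"

record ('o, 'm) additive_category = "('o, 'm) category" +
  Zero :: "'o \<Rightarrow> 'o \<Rightarrow> 'm"
  Plus :: "'o \<Rightarrow> 'o \<Rightarrow> 'm \<Rightarrow> 'm \<Rightarrow> 'm"
  Neg :: "'o \<Rightarrow> 'o \<Rightarrow> 'm \<Rightarrow> 'm"

record ('o, 'm) shift_category = "('o, 'm) additive_category" +
  Sh_ob :: "'o \<Rightarrow> 'o"
  Sh_mor :: "'o \<Rightarrow> 'o \<Rightarrow> 'm \<Rightarrow> 'm"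

text \<open>
  Membership of \<open>x\<close> and \<open>y\<close> in \<open>Ob C\<close> is not part of \<open>isomorphic C x y\<close>; hence
  \<open>\<not> isomorphic C x y\<close> never holds merely because \<open>x\<close> or \<open>y\<close> fails to be an object.
\<close>

definition isomorphic :: "('o, 'm, 'c) category_scheme \<Rightarrow> 'o \<Rightarrow> 'o \<Rightarrow> bool" where
  "isomorphic C x y \<longleftrightarrow>
     (\<exists>f\<in>Hom C x y. \<exists>g\<in>Hom C y x. Comp C x y x f g = Id C x \<and> Comp C y x y g f = Id C y)"

definition mono_in :: "('o, 'm, 'c) category_scheme \<Rightarrow> 'o \<Rightarrow> 'o \<Rightarrow> 'm \<Rightarrow> bool" where
  "mono_in C x y f \<longleftrightarrow> f \<in> Hom C x y \<and>
     (\<forall>t\<in>Ob C. \<forall>g\<in>Hom C t x. \<forall>h\<in>Hom C t x. Comp C t x y g f = Comp C t x y h f \<longrightarrow> g = h)"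

definition epi_in :: "('o, 'm, 'c) category_scheme \<Rightarrow> 'o \<Rightarrow> 'o \<Rightarrow> 'm \<Rightarrow> bool" where
  "epi_in C x y f \<longleftrightarrow> f \<in> Hom C x y \<and>
     (\<forall>t\<in>Ob C. \<forall>g\<in>Hom C y t. \<forall>h\<in>Hom C y t. Comp C x y t f g = Comp C x y t f h \<longrightarrow> g = h)"

definition projective_in :: "('o, 'm, 'c) category_scheme \<Rightarrow> 'o \<Rightarrow> bool" where
  "projective_in C a \<longleftrightarrow> a \<in> Ob C \<and>
     (\<forall>x\<in>Ob C. \<forall>y\<in>Ob C. \<forall>e. epi_in C x y e \<longrightarrow>
        (\<forall>f\<in>Hom C a y. \<exists>h\<in>Hom C a x. Comp C a x y h e = f))"

definition injective_in :: "('o, 'm, 'c) category_scheme \<Rightarrow> 'o \<Rightarrow> bool" where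
  "injective_in C a \<longleftrightarrow> a \<in> Ob C \<and>
     (\<forall>x\<in>Ob C. \<forall>y\<in>Ob C. \<forall>e. mono_in C x y e \<longrightarrow>
        (\<forall>f\<in>Hom C x a. \<exists>h\<in>Hom C y a. Comp C x y a e h = f))"

definition bijective_in :: "('o, 'm, 'c) category_scheme \<Rightarrow> 'o \<Rightarrow> bool" where
  "bijective_in C a \<longleftrightarrow> projective_in C a \<and> injective_in C a"

definition weak_kernel ::
  "('o, 'm, 'c) additive_category_scheme \<Rightarrow> 'o \<Rightarrow> 'o \<Rightarrow> 'o \<Rightarrow> 'm \<Rightarrow> 'm \<Rightarrow> bool" where
  "weak_kernel C a b c f g \<longleftrightarrow> f \<in> Hom C a b \<and> g \<in> Hom C b c \<and> Comp C a b c f g = Zero C a c \<and>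
     (\<forall>t\<in>Ob C. \<forall>h\<in>Hom C t b. Comp C t b c h g = Zero C t c \<longrightarrow>
        (\<exists>k\<in>Hom C t a. Comp C t a b k f = h))"

definition weak_cokernel ::
  "('o, 'm, 'c) additive_category_scheme \<Rightarrow> 'o \<Rightarrow> 'o \<Rightarrow> 'o \<Rightarrow> 'm \<Rightarrow> 'm \<Rightarrow> bool" where
  "weak_cokernel C a b c f g \<longleftrightarrow> f \<in> Hom C a b \<and> g \<in> Hom C b c \<and> Comp C a b c f g = Zero C a c \<and>
     (\<forall>t\<in>Ob C. \<forall>h\<in>Hom C b t. Comp C a b t f h = Zero C a t \<longrightarrow>
        (\<exists>k\<in>Hom C c t. Comp C b c t g k = h))"

definition zero_object :: "('o, 'm, 'c) additive_category_scheme \<Rightarrow> 'o \<Rightarrow> bool" where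
  "zero_object C x \<longleftrightarrow> x \<in> Ob C \<and> Id C x = Zero C x x"

definition biproduct ::
  "('o, 'm, 'c) additive_category_scheme \<Rightarrow> 'o \<Rightarrow> 'o \<Rightarrow> 'o \<Rightarrow> 'm \<Rightarrow> 'm \<Rightarrow> 'm \<Rightarrow> 'm \<Rightarrow> bool" where
  "biproduct C b c s ib ic pb pc \<longleftrightarrow> s \<in> Ob C \<and>
     ib \<in> Hom C b s \<and> ic \<in> Hom C c s \<and> pb \<in> Hom C s b \<and> pc \<in> Hom C s c \<and>
     Comp C b s b ib pb = Id C b \<and> Comp C c s c ic pc = Id C c \<and>
     Comp C b s c ib pc = Zero C b c \<and> Comp C c s b ic pb = Zero C c b \<and>
     Plus C s s (Comp C s b s pb ib) (Comp C s c s pc ic) = Id C s"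

text \<open>
  \<open>weak_square C a b c d f g h k\<close>: the quadrangle with \<open>f : a \<rightarrow> b\<close>, \<open>g : a \<rightarrow> c\<close>, \<open>h : b \<rightarrow> d\<close>,
  \<open>k : c \<rightarrow> d\<close>. The sequence \<open>a \<rightarrow> b \<oplus> c \<rightarrow> d\<close> has the components \<open>f, g\<close> and \<open>h, -k\<close>.
\<close>

definition weak_square ::
  "('o, 'm, 'c) additive_category_scheme \<Rightarrow> 'o \<Rightarrow> 'o \<Rightarrow> 'o \<Rightarrow> 'o \<Rightarrow> 'm \<Rightarrow> 'm \<Rightarrow> 'm \<Rightarrow> 'm \<Rightarrow> bool"
where
  "weak_square C a b c d f g h k \<longleftrightarrow>
     f \<in> Hom C a b \<and> g \<in> Hom C a c \<and> h \<in> Hom C b d \<and> k \<in> Hom C c d \<and>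
     Comp C a b d f h = Comp C a c d g k \<and>
     (\<exists>s ib ic pb pc. biproduct C b c s ib ic pb pc \<and>
        (let u = Plus C a s (Comp C a b s f ib) (Comp C a c s g ic);
             v = Plus C s d (Comp C s b d pb h) (Neg C s d (Comp C s c d pc k))
         in weak_kernel C a s d u v \<and> weak_cokernel C a s d u v))"

text \<open>
  The quotient of \<open>E\<close> by its bijective objects: morphisms are classes of morphisms of \<open>E\<close>, two
  of which are identified if their difference factors over a bijective object.
\<close>

definition stable_eq :: "('o, 'm, 'c) additive_category_scheme \<Rightarrow> 'o \<Rightarrow> 'o \<Rightarrow> 'm rel" where
  "stable_eq E x y = {(f, g). f \<in> Hom E x y \<and> g \<in> Hom E x y \<and>
     (\<exists>b u v. bijective_in E b \<and> u \<in> Hom E x b \<and> v \<in> Hom E b y \<and>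
        g = Plus E x y f (Comp E x b y u v))}"

definition stable_category ::
  "('o, 'm) additive_category \<Rightarrow> ('o, 'm set) additive_category" where
  "stable_category E =
     \<lparr>Ob = Ob E,
      Hom = (\<lambda>x y. Hom E x y // stable_eq E x y),
      Id = (\<lambda>x. stable_eq E x x `` {Id E x}),
      Comp = (\<lambda>x y z F G. \<Union>f\<in>F. \<Union>g\<in>G. stable_eq E x z `` {Comp E x y z f g}),
      Zero = (\<lambda>x y. stable_eq E x y `` {Zero E x y}),
      Plus = (\<lambda>x y F G. \<Union>f\<in>F. \<Union>g\<in>G. stable_eq E x y `` {Plus E x y f g}),
      Neg = (\<lambda>x y F. \<Union>f\<in>F. stable_eq E x y `` {Neg E x y f})\<rparr>"


section \<open>Posets\<close>

text \<open>
  The symbol \<open>i\<close> with exponent \<open>+z\<close> is the pair \<open>(i, z)\<close>; the point \<open>\<beta>/\<alpha>\<close> is the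
  pair \<open>(\<beta>, \<alpha>)\<close>.
\<close>

type_synonym sym = "nat \<times> int"
type_synonym point = "sym \<times> sym"

definition sym_set :: "nat \<Rightarrow> sym set" where
  "sym_set n = {a. fst a \<le> n}"

definition sym_le :: "sym \<Rightarrow> sym \<Rightarrow> bool" where
  "sym_le a b \<longleftrightarrow> snd a < snd b \<or> snd a = snd b \<and> fst a \<le> fst b"

definition sym_shift :: "int \<Rightarrow> sym \<Rightarrow> sym" where
  "sym_shift w a = (fst a, snd a + w)"

definition strip :: "nat \<Rightarrow> point set" where
  "strip n = {(b, a). a \<in> sym_set n \<and> b \<in> sym_set n \<and>
     sym_le (sym_shift (-1) b) a \<and> sym_le a b \<and> sym_le b (sym_shift 1 a)}"

definition point_le :: "point \<Rightarrow> point \<Rightarrow> bool" where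
  "point_le u v \<longleftrightarrow> sym_le (fst u) (fst v) \<and> sym_le (snd u) (snd v)"

definition point_shift :: "point \<Rightarrow> point" where
  "point_shift u = (sym_shift 1 (snd u), fst u)"


section \<open>Pretriangles\<close>

record ('o, 'm) diagram =
  dob :: "point \<Rightarrow> 'o"
  darr :: "point \<Rightarrow> point \<Rightarrow> 'm"

definition is_functor ::
  "nat \<Rightarrow> ('o, 'm, 'c) shift_category_scheme \<Rightarrow> ('o, 'm) diagram \<Rightarrow> bool" where
  "is_functor n C X \<longleftrightarrow>
     (\<forall>u\<in>strip n. dob X u \<in> Ob C \<and> darr X u u = Id C (dob X u)) \<and>
     (\<forall>u\<in>strip n. \<forall>v\<in>strip n. point_le u v \<longrightarrow> darr X u v \<in> Hom C (dob X u) (dob X v)) \<and>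
     (\<forall>u\<in>strip n. \<forall>v\<in>strip n. \<forall>w\<in>strip n. point_le u v \<longrightarrow> point_le v w \<longrightarrow>
        Comp C (dob X u) (dob X v) (dob X w) (darr X u v) (darr X v w) = darr X u w)"

definition is_pretriangle ::
  "nat \<Rightarrow> ('o, 'm, 'c) shift_category_scheme \<Rightarrow> ('o, 'm) diagram \<Rightarrow> bool" where
  "is_pretriangle n C X \<longleftrightarrow> is_functor n C X \<and>
     (\<forall>a\<in>sym_set n. zero_object C (dob X (a, a)) \<and> zero_object C (dob X (sym_shift 1 a, a))) \<and>
     (\<forall>a\<in>sym_set n. \<forall>b\<in>sym_set n. \<forall>c\<in>sym_set n. \<forall>d\<in>sym_set n.
        sym_le (sym_shift (-1) d) a \<longrightarrow> sym_le a b \<longrightarrow> sym_le b c \<longrightarrow> sym_le c d \<longrightarrow>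
        sym_le d (sym_shift 1 a) \<longrightarrow>
        weak_square C (dob X (c, a)) (dob X (d, a)) (dob X (c, b)) (dob X (d, b))
          (darr X (c, a) (d, a)) (darr X (c, a) (c, b))
          (darr X (d, a) (d, b)) (darr X (c, b) (d, b)))"

definition is_periodic ::
  "nat \<Rightarrow> ('o, 'm, 'c) shift_category_scheme \<Rightarrow> ('o, 'm) diagram \<Rightarrow> bool" where
  "is_periodic n C X \<longleftrightarrow>
     (\<forall>u\<in>strip n. dob X (point_shift u) = Sh_ob C (dob X u)) \<and>
     (\<forall>u\<in>strip n. \<forall>v\<in>strip n. point_le u v \<longrightarrow>
        darr X (point_shift u) (point_shift v) = Sh_mor C (dob X u) (dob X v) (darr X u v))"

definition periodic_transformations ::
  "nat \<Rightarrow> ('o, 'm, 'c) shift_category_scheme \<Rightarrow> ('o, 'm) diagram \<Rightarrow> ('o, 'm) diagram \<Rightarrow>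
    (point \<Rightarrow> 'm) set" where
  "periodic_transformations n C X Y =
     {f \<in> extensional (strip n).
        (\<forall>u\<in>strip n. f u \<in> Hom C (dob X u) (dob Y u)) \<and>
        (\<forall>u\<in>strip n. \<forall>v\<in>strip n. point_le u v \<longrightarrow>
           Comp C (dob X u) (dob Y u) (dob Y v) (f u) (darr Y u v) =
           Comp C (dob X u) (dob X v) (dob Y v) (darr X u v) (f v)) \<and>
        (\<forall>u\<in>strip n. f (point_shift u) = Sh_mor C (dob X u) (dob Y u) (f u))}"

definition periodic_pretriangles ::
  "nat \<Rightarrow> ('o, 'm, 'c) shift_category_scheme \<Rightarrow> (('o, 'm) diagram, point \<Rightarrow> 'm) category" where
  "periodic_pretriangles n C =
     \<lparr>Ob = {X. is_pretriangle n C X \<and> is_periodic n C X},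
      Hom = periodic_transformations n C,
      Id = (\<lambda>X. \<lambda>u\<in>strip n. Id C (dob X u)),
      Comp = (\<lambda>X Y Z f g. \<lambda>u\<in>strip n. Comp C (dob X u) (dob Y u) (dob Z u) (f u) (g u))\<rparr>"


section \<open>The stable category of finite modules\<close>

text \<open>
  A tuple of multiplicities is encoded as the sorted list of the exponents of the cyclic
  summands; exponent \<open>0\<close> (a trivial summand) is allowed and is counted. Elements of the module
  are families of residues indexed by the positions of the list. The fields \<open>mult\<close> and \<open>one\<close> of
  the module record play no role.
\<close>

definition cyc_sum :: "nat \<Rightarrow> nat list \<Rightarrow> (int, nat \<Rightarrow> int) module" where
  "cyc_sum p L =
     \<lparr>carrier = (\<Pi>\<^sub>E k\<in>{..<length L}. {0..<int p ^ (L ! k)}),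
      monoid.mult = undefined,
      one = undefined,
      zero = (\<lambda>k\<in>{..<length L}. 0),
      add = (\<lambda>x y. \<lambda>k\<in>{..<length L}. (x k + y k) mod int p ^ (L ! k)),
      smult = (\<lambda>r x. \<lambda>k\<in>{..<length L}. (r * x k) mod int p ^ (L ! k))\<rparr>"

definition linear_maps ::
  "('r, 's) ring_scheme \<Rightarrow> ('r, 'a) module \<Rightarrow> ('r, 'b) module \<Rightarrow> ('a \<Rightarrow> 'b) set" where
  "linear_maps R M N = {f \<in> carrier M \<rightarrow>\<^sub>E carrier N.
     (\<forall>x\<in>carrier M. \<forall>y\<in>carrier M. f (x \<oplus>\<^bsub>M\<^esub> y) = f x \<oplus>\<^bsub>N\<^esub> f y) \<and>
     (\<forall>r\<in>carrier R. \<forall>x\<in>carrier M. f (r \<odot>\<^bsub>M\<^esub> x) = r \<odot>\<^bsub>N\<^esub> f x)}"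

type_synonym lin_map = "(nat \<Rightarrow> int) \<Rightarrow> (nat \<Rightarrow> int)"

definition mod_category :: "nat \<Rightarrow> nat \<Rightarrow> (nat list, lin_map) additive_category" where
  "mod_category p m =
     \<lparr>Ob = {L. sorted L \<and> set L \<subseteq> {..m}},
      Hom = (\<lambda>L N. linear_maps (residue_ring (int p ^ m)) (cyc_sum p L) (cyc_sum p N)),
      Id = (\<lambda>L. \<lambda>x\<in>carrier (cyc_sum p L). x),
      Comp = (\<lambda>L M N f g. compose (carrier (cyc_sum p L)) g f),
      Zero = (\<lambda>L N. \<lambda>x\<in>carrier (cyc_sum p L). \<zero>\<^bsub>cyc_sum p N\<^esub>),
      Plus = (\<lambda>L N f g. \<lambda>x\<in>carrier (cyc_sum p L). f x \<oplus>\<^bsub>cyc_sum p N\<^esub> g x),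
      Neg = (\<lambda>L N f. \<lambda>x\<in>carrier (cyc_sum p L). \<ominus>\<^bsub>cyc_sum p N\<^esub> f x)\<rparr>"

text \<open>
  Linear maps and matrices. Matrices act on row vectors: the entry in row \<open>r\<close>, column \<open>s\<close> is the
  component from the \<open>r\<close>-th summand of the source to the \<open>s\<close>-th summand of the target.
\<close>

definition mat_map :: "nat \<Rightarrow> nat list \<Rightarrow> nat list \<Rightarrow> (nat \<Rightarrow> nat \<Rightarrow> int) \<Rightarrow> lin_map" where
  "mat_map p L N A = (\<lambda>x\<in>carrier (cyc_sum p L).
     \<lambda>s\<in>{..<length N}. (\<Sum>r<length L. x r * A r s) mod int p ^ (N ! s))"

definition unit_elt :: "nat \<Rightarrow> nat list \<Rightarrow> nat \<Rightarrow> (nat \<Rightarrow> int)" where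
  "unit_elt p L r = (\<lambda>k\<in>{..<length L}. if k = r then 1 mod int p ^ (L ! k) else 0)"

definition mat_of :: "nat \<Rightarrow> nat list \<Rightarrow> lin_map \<Rightarrow> nat \<Rightarrow> nat \<Rightarrow> int" where
  "mat_of p L f r s = f (unit_elt p L r) s"

definition shift_obj :: "nat \<Rightarrow> nat list \<Rightarrow> nat list" where
  "shift_obj m L = rev (map (\<lambda>i. m - i) L)"

text \<open>
  The entry \<open>p\<^bsup>i-j\<^esup> a\<close>; for \<open>i < j\<close> the entry \<open>a\<close> of a linear map is a multiple of
  \<open>p\<^bsup>j-i\<^esup>\<close> and the division is exact.
\<close>

definition shift_entry :: "nat \<Rightarrow> nat \<Rightarrow> nat \<Rightarrow> int \<Rightarrow> int" where
  "shift_entry p i j a = (if j \<le> i then int p ^ (i - j) * a else a div int p ^ (j - i))"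

definition shift_map :: "nat \<Rightarrow> nat \<Rightarrow> nat list \<Rightarrow> nat list \<Rightarrow> lin_map \<Rightarrow> lin_map" where
  "shift_map p m L N f = mat_map p (shift_obj m L) (shift_obj m N)
     (\<lambda>r s. let r' = length L - 1 - r; s' = length N - 1 - s
            in shift_entry p (L ! r') (N ! s') (mat_of p L f r' s'))"

definition stable_mod :: "nat \<Rightarrow> nat \<Rightarrow> (nat list, lin_map set) shift_category" where
  "stable_mod p m = additive_category.extend (stable_category (mod_category p m))
     \<lparr>Sh_ob = shift_obj m,
      Sh_mor = (\<lambda>L N F. \<Union>f\<in>F.
         stable_eq (mod_category p m) (shift_obj m L) (shift_obj m N) `` {shift_map p m L N f})\<rparr>"


section \<open>The diagrams\<close>

text \<open>
  Every point of the strip is a shift \<open>(j/i)\<^sup>+\<^sup>k\<close> for unique \<open>0 \<le> i \<le> j \<le> n\<close> and integer \<open>k\<close>: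
  if \<open>\<alpha>\<close>, \<open>\<beta>\<close> are \<open>i\<close>, \<open>j\<close> with the same exponent \<open>z\<close>, then \<open>\<beta>/\<alpha>\<close> is \<open>(j/i)\<close> shifted \<open>2z\<close>
  times; otherwise the exponents are \<open>z\<close>, \<open>z+1\<close> with \<open>j \<le> i\<close>, and \<open>\<beta>/\<alpha>\<close> is \<open>(i/j)\<close> shifted
  \<open>2z+1\<close> times. A periodic diagram is therefore determined by its objects at \<open>j/i\<close> and
  by its arrows \<open>j/i \<rightarrow> (j+1)/i\<close> and \<open>j/i \<rightarrow> j/(i+1)\<close> for \<open>0 \<le> i \<le> j \<le> n\<close>, where
  \<open>n+1\<close> stands for \<open>0\<close> with exponent \<open>+1\<close>. The shift of \<open>stable_mod\<close> squares to the identity,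
  so that only the parity of \<open>k\<close> matters. The odd case also produces the prescribed entries at
  \<open>0\<^sup>+\<^sup>1/i\<close>, namely the objects \<open>\<int>/p\<^sup>n\<close> and the arrows \<open>0\<^sup>+\<^sup>1/i \<rightarrow> 0\<^sup>+\<^sup>1/(i+1)\<close> given by \<open>p\<close>, as
  shifts of those at \<open>i/0\<close>.
\<close>

definition sym_succ :: "nat \<Rightarrow> sym \<Rightarrow> sym" where
  "sym_succ n a = (if fst a < n then (fst a + 1, snd a) else (0, snd a + 1))"

definition sym_index :: "nat \<Rightarrow> sym \<Rightarrow> int" where
  "sym_index n a = snd a * (int n + 1) + int (fst a)"

definition ext_ob ::
  "('o, 'm, 'c) shift_category_scheme \<Rightarrow> (nat \<Rightarrow> nat \<Rightarrow> 'o) \<Rightarrow> point \<Rightarrow> 'o" where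
  "ext_ob C ob u = (case u of ((j, w), (i, z)) \<Rightarrow> if w = z then ob j i else Sh_ob C (ob i j))"

text \<open>
  The parameters \<open>num j i\<close> and \<open>den j i\<close> are the arrows \<open>j/i \<rightarrow> (j+1)/i\<close> and \<open>j/i \<rightarrow> j/(i+1)\<close>,
  increasing numerator resp. denominator. The shift exchanges the two directions.
\<close>

definition ext_num ::
  "nat \<Rightarrow> ('o, 'm, 'c) shift_category_scheme \<Rightarrow> (nat \<Rightarrow> nat \<Rightarrow> 'o) \<Rightarrow> (nat \<Rightarrow> nat \<Rightarrow> 'm) \<Rightarrow>
    (nat \<Rightarrow> nat \<Rightarrow> 'm) \<Rightarrow> point \<Rightarrow> 'm" where
  "ext_num n C ob num den u = (case u of ((j, w), (i, z)) \<Rightarrow>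
     if w = z then num j i
     else Sh_mor C (ext_ob C ob ((i, 0), (j, 0))) (ext_ob C ob ((i, 0), sym_succ n (j, 0))) (den i j))"

definition ext_den ::
  "nat \<Rightarrow> ('o, 'm, 'c) shift_category_scheme \<Rightarrow> (nat \<Rightarrow> nat \<Rightarrow> 'o) \<Rightarrow> (nat \<Rightarrow> nat \<Rightarrow> 'm) \<Rightarrow>
    (nat \<Rightarrow> nat \<Rightarrow> 'm) \<Rightarrow> point \<Rightarrow> 'm" where
  "ext_den n C ob num den u = (case u of ((j, w), (i, z)) \<Rightarrow>
     if w = z then den j i
     else Sh_mor C (ext_ob C ob ((i, 0), (j, 0))) (ext_ob C ob (sym_succ n (i, 0), (j, 0))) (num i j))"

text \<open>
  The path from \<open>u\<close> to \<open>v\<close> increases the numerator as long as it neither exceeds that of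
  \<open>v\<close> nor leaves the strip, and the denominator otherwise. \<open>ext_path\<close> composes the steps of this
  path; its argument of type \<^typ>\<open>nat\<close> is the number of steps.
\<close>

definition goes_num :: "nat \<Rightarrow> point \<Rightarrow> point \<Rightarrow> bool" where
  "goes_num n u v \<longleftrightarrow> sym_le (sym_succ n (fst u)) (fst v) \<and>
     sym_le (sym_succ n (fst u)) (sym_shift 1 (snd u))"

definition next_point :: "nat \<Rightarrow> point \<Rightarrow> point \<Rightarrow> point" where
  "next_point n u v =
     (if goes_num n u v then (sym_succ n (fst u), snd u) else (fst u, sym_succ n (snd u)))"

definition ext_step ::
  "nat \<Rightarrow> ('o, 'm, 'c) shift_category_scheme \<Rightarrow> (nat \<Rightarrow> nat \<Rightarrow> 'o) \<Rightarrow> (nat \<Rightarrow> nat \<Rightarrow> 'm) \<Rightarrow>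
    (nat \<Rightarrow> nat \<Rightarrow> 'm) \<Rightarrow> point \<Rightarrow> point \<Rightarrow> 'm" where
  "ext_step n C ob num den u v =
     (if goes_num n u v then ext_num n C ob num den u else ext_den n C ob num den u)"

fun ext_path ::
  "nat \<Rightarrow> ('o, 'm, 'c) shift_category_scheme \<Rightarrow> (nat \<Rightarrow> nat \<Rightarrow> 'o) \<Rightarrow> (nat \<Rightarrow> nat \<Rightarrow> 'm) \<Rightarrow>
    (nat \<Rightarrow> nat \<Rightarrow> 'm) \<Rightarrow> nat \<Rightarrow> point \<Rightarrow> point \<Rightarrow> 'm" where
  "ext_path n C ob num den 0 u v = Id C (ext_ob C ob u)"
| "ext_path n C ob num den (Suc 0) u v = ext_step n C ob num den u v"
| "ext_path n C ob num den (Suc (Suc k)) u v =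
     (let w = next_point n u v
      in Comp C (ext_ob C ob u) (ext_ob C ob w) (ext_ob C ob v)
           (ext_step n C ob num den u v) (ext_path n C ob num den (Suc k) w v))"

definition periodic_extension ::
  "nat \<Rightarrow> ('o, 'm, 'c) shift_category_scheme \<Rightarrow> (nat \<Rightarrow> nat \<Rightarrow> 'o) \<Rightarrow> (nat \<Rightarrow> nat \<Rightarrow> 'm) \<Rightarrow>
    (nat \<Rightarrow> nat \<Rightarrow> 'm) \<Rightarrow> ('o, 'm) diagram" where
  "periodic_extension n C ob num den =
     \<lparr>dob = ext_ob C ob,
      darr = (\<lambda>u v. ext_path n C ob num den
         (nat (sym_index n (fst v) - sym_index n (fst u) + sym_index n (snd v) - sym_index n (snd u)))
         u v)\<rparr>"

definition base_ob :: "nat \<Rightarrow> nat \<Rightarrow> nat \<Rightarrow> nat list" where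
  "base_ob n j i = (if i = j then [] else if i = 0 then [n] else [j - i, 2 * n - (j - i)])"

definition mat_class :: "nat \<Rightarrow> nat \<Rightarrow> nat list \<Rightarrow> nat list \<Rightarrow> int list list \<Rightarrow> lin_map set" where
  "mat_class p m L N A =
     stable_eq (mod_category p m) L N `` {mat_map p L N (\<lambda>r s. A ! r ! s)}"

text \<open>
  Matrices by rows. If the source or the target of an arrow is the empty direct sum, its
  matrix is not looked up.
\<close>

definition X_num :: "nat \<Rightarrow> nat \<Rightarrow> nat \<Rightarrow> nat \<Rightarrow> int list list" where
  "X_num p n j i =
     (if i = 0 then [[int p]]
      else if j < n then [[int p, 0], [0, 1]]
      else [[- (int p ^ i)], [1]])"

definition X_den :: "nat \<Rightarrow> nat \<Rightarrow> nat \<Rightarrow> nat \<Rightarrow> int list list" where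
  "X_den p n j i =
     (if i = 0 then [[1, int p ^ (n - j + 1)]]
      else [[1, 0], [0, int p]])"

definition Xt_num :: "nat \<Rightarrow> nat \<Rightarrow> nat \<Rightarrow> nat \<Rightarrow> int list list" where
  "Xt_num p n j i =
     (if j = n - 1 \<and> i = 1 then [[int p, 0], [int p ^ (n - 3), 1]] else X_num p n j i)"

definition Xt_den :: "nat \<Rightarrow> nat \<Rightarrow> nat \<Rightarrow> nat \<Rightarrow> int list list" where
  "Xt_den p n j i =
     (if j = n \<and> i = 1 then [[1, 0], [- (int p ^ (n - 3)), int p]] else X_den p n j i)"

definition matrix_diagram ::
  "nat \<Rightarrow> nat \<Rightarrow> (nat \<Rightarrow> nat \<Rightarrow> int list list) \<Rightarrow> (nat \<Rightarrow> nat \<Rightarrow> int list list) \<Rightarrow>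
    (nat list, lin_map set) diagram" where
  "matrix_diagram p n num den =
     (let m = 2 * n; C = stable_mod p m; ob = base_ob n
      in periodic_extension n C ob
           (\<lambda>j i. mat_class p m (ob j i) (ext_ob C ob (sym_succ n (j, 0), (i, 0))) (num j i))
           (\<lambda>j i. mat_class p m (ob j i) (ob j (i + 1)) (den j i)))"

definition X_diag :: "nat \<Rightarrow> nat \<Rightarrow> (nat list, lin_map set) diagram" where
  "X_diag p n = matrix_diagram p n (X_num p n) (X_den p n)"

definition Xt_diag :: "nat \<Rightarrow> nat \<Rightarrow> (nat list, lin_map set) diagram" where
  "Xt_diag p n = matrix_diagram p n (Xt_num p n) (Xt_den p n)"

end

theory Submission
  imports Defs
begin

text \<open>
  A stable morphism between sums of cyclic modules determines the matrix entry
  \<open>\<int>/p\<^sup>i \<rightarrow> \<int>/p\<^sup>j\<close> modulo \<open>p\<close> to the power \<open>min (m - i) j\<close>, so commuting squares in the stable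
  category become congruences. For a periodic morphism from \<open>X\<close> to \<open>X~\<close> write \<open>A j\<close> for the entry at \<open>j/0\<close>
  and \<open>b j\<close>, \<open>c j\<close>, \<open>d j\<close>, \<open>e j\<close> for the entries, by rows, at \<open>j/1\<close>. Along \<open>2/1 \<rightarrow> \<dots> \<rightarrow> n/1\<close> the
  modification of \<open>X\<close> forces \<open>d n\<close> to be congruent to \<open>p\<^sup>n\<^sup>-\<^sup>3 e n\<close> modulo \<open>p\<^sup>n\<^sup>-\<^sup>2\<close>, while \<open>p\<^sup>n\<close> divides \<open>c n\<close>.
  By periodicity the entry at the shift of \<open>0\<close> over \<open>1\<close> is again \<open>A 1\<close>. Comparing the squares from \<open>n/0\<close>
  to \<open>n/1\<close> and from \<open>n/1\<close> to that point, and using that \<open>A 1\<close> and \<open>A n\<close> agree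
  modulo \<open>p\<^sup>n\<^sup>-\<^sup>1\<close>, gives that \<open>p\<^sup>n\<^sup>-\<^sup>2\<close> divides \<open>d n\<close>.
  Hence \<open>p\<close> divides \<open>e n\<close> and then \<open>A 1\<close>, which is therefore not invertible.
\<close>

section \<open>Linear maps and their matrices\<close>

lemma carrier_cyc_sum_iff:
  "x \<in> carrier (cyc_sum p L) \<longleftrightarrow>
     x \<in> extensional {..<length L} \<and> (\<forall>k<length L. 0 \<le> x k \<and> x k < int p ^ (L ! k))"
  by (auto simp: cyc_sum_def PiE_iff)

lemma mod_category_simps [simp]:
  "Ob (mod_category p m) = {L. sorted L \<and> set L \<subseteq> {..m}}"
  "Hom (mod_category p m) L N = linear_maps (residue_ring (int p ^ m)) (cyc_sum p L) (cyc_sum p N)"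
  "Comp (mod_category p m) L M N f g = compose (carrier (cyc_sum p L)) g f"
  "Id (mod_category p m) L = (\<lambda>x\<in>carrier (cyc_sum p L). x)"
  by (simp_all add: mod_category_def)

lemma nth_Ob_mod_category: "L \<in> Ob (mod_category p m) \<Longrightarrow> k < length L \<Longrightarrow> L ! k \<le> m"
  using nth_mem by fastforce

lemma linear_maps_eqI:
  assumes "f \<in> linear_maps R M N" "g \<in> linear_maps R M N" "\<And>x. x \<in> carrier M \<Longrightarrow> f x = g x"
  shows "f = g"
  using assms by (auto simp: linear_maps_def intro: PiE_ext)

lemma linear_maps_compose:
  assumes "f \<in> linear_maps R L M" "g \<in> linear_maps R M N"
    and "\<And>x y. x \<in> carrier L \<Longrightarrow> y \<in> carrier L \<Longrightarrow> x \<oplus>\<^bsub>L\<^esub> y \<in> carrier L"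
    and "\<And>r x. r \<in> carrier R \<Longrightarrow> x \<in> carrier L \<Longrightarrow> r \<odot>\<^bsub>L\<^esub> x \<in> carrier L"
  shows "compose (carrier L) g f \<in> linear_maps R L N"
  using assms by (auto simp: linear_maps_def compose_def PiE_iff)

context
  fixes p :: nat
  assumes p: "p > 1"
begin

lemma cyc_sum_add_closed:
  "x \<in> carrier (cyc_sum p L) \<Longrightarrow> y \<in> carrier (cyc_sum p L) \<Longrightarrow>
     x \<oplus>\<^bsub>cyc_sum p L\<^esub> y \<in> carrier (cyc_sum p L)"
  using p by (auto simp: cyc_sum_def)

lemma cyc_sum_smult_closed: "r \<odot>\<^bsub>cyc_sum p L\<^esub> x \<in> carrier (cyc_sum p L)"
  using p by (auto simp: cyc_sum_def)

lemma cyc_sum_zero_closed: "\<zero>\<^bsub>cyc_sum p L\<^esub> \<in> carrier (cyc_sum p L)"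
  using p by (auto simp: cyc_sum_def)

lemma unit_elt_closed: "unit_elt p L r \<in> carrier (cyc_sum p L)"
  using p by (auto simp: cyc_sum_def unit_elt_def)

lemma Hom_apply_closed:
  "f \<in> Hom (mod_category p m) L N \<Longrightarrow> x \<in> carrier (cyc_sum p L) \<Longrightarrow> f x \<in> carrier (cyc_sum p N)"
  by (auto simp: linear_maps_def)

lemma Hom_comp_closed:
  assumes "f \<in> Hom (mod_category p m) L M" "g \<in> Hom (mod_category p m) M N"
  shows "Comp (mod_category p m) L M N f g \<in> Hom (mod_category p m) L N"
  unfolding mod_category_simps
  by (rule linear_maps_compose[OF assms[unfolded mod_category_simps] cyc_sum_add_closed cyc_sum_smult_closed])

text \<open>An entry of a matrix defines a map on residues precisely because \<open>p\<close> to the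
  power \<open>L ! r\<close> times that entry vanishes in the target summand. Truncated subtraction
  makes the condition void for \<open>N ! s <= L ! r\<close>.\<close>

lemma mat_map_linear:
  assumes L: "\<And>r s. r < length L \<Longrightarrow> s < length N \<Longrightarrow> int p ^ (N ! s - L ! r) dvd A r s"
  shows "mat_map p L N A \<in> linear_maps R (cyc_sum p L) (cyc_sum p N)"
proof -
  let ?c = "carrier (cyc_sum p L)"
  \<comment> \<open>Reducing a coordinate changes it by a multiple of \<open>p ^ (L ! r)\<close>;
    the factor \<open>p ^ (N ! s - L ! r)\<close> in the entry supplies the rest of the
    modulus.\<close>
  have red: "[(z mod int p ^ (L ! r)) * A r s = z * A r s] (mod int p ^ (N ! s))"
    if "r < length L" "s < length N" for z r s
  proof -
    have "int p ^ (N ! s) dvd int p ^ (L ! r + (N ! s - L ! r))"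
      by (rule le_imp_power_dvd) auto
    also have "\<dots> dvd (z mod int p ^ (L ! r) - z) * A r s"
      unfolding power_add using L[OF that]
      by (intro mult_dvd_mono) (simp add: mod_eq_dvd_iff[symmetric])
    finally show ?thesis by (simp add: cong_iff_dvd_diff algebra_simps)
  qed
  have 1: "mat_map p L N A \<in> ?c \<rightarrow>\<^sub>E carrier (cyc_sum p N)"
    using p by (auto simp: mat_map_def cyc_sum_def)
  have 2: "mat_map p L N A (x \<oplus>\<^bsub>cyc_sum p L\<^esub> y) = mat_map p L N A x \<oplus>\<^bsub>cyc_sum p N\<^esub> mat_map p L N A y"
    if x: "x \<in> ?c" and y: "y \<in> ?c" for x y
  proof -
    have "(\<Sum>r<length L. (x r + y r) mod int p ^ (L ! r) * A r s) mod int p ^ (N ! s) =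
      ((\<Sum>r<length L. x r * A r s) mod int p ^ (N ! s) +
       (\<Sum>r<length L. y r * A r s) mod int p ^ (N ! s)) mod int p ^ (N ! s)"
      if s: "s < length N" for s
    proof -
      have "[(\<Sum>r<length L. (x r + y r) mod int p ^ (L ! r) * A r s) = (\<Sum>r<length L. (x r + y r) * A r s)]
          (mod int p ^ (N ! s))"
        by (intro cong_sum red s) auto
      then show ?thesis
        by (simp add: cong_def mod_add_eq sum.distrib algebra_simps)
    qed
    then show ?thesis
      using cyc_sum_add_closed[OF x y] x y
      by (simp add: mat_map_def) (auto simp: cyc_sum_def intro!: restrict_ext)
  qed
  have 3: "mat_map p L N A (a \<odot>\<^bsub>cyc_sum p L\<^esub> x) = a \<odot>\<^bsub>cyc_sum p N\<^esub> mat_map p L N A x"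
    if x: "x \<in> ?c" for a x
  proof -
    have "(\<Sum>r<length L. (a * x r) mod int p ^ (L ! r) * A r s) mod int p ^ (N ! s) =
      (a * ((\<Sum>r<length L. x r * A r s) mod int p ^ (N ! s))) mod int p ^ (N ! s)"
      if s: "s < length N" for s
    proof -
      have "[(\<Sum>r<length L. (a * x r) mod int p ^ (L ! r) * A r s) = (\<Sum>r<length L. (a * x r) * A r s)]
          (mod int p ^ (N ! s))"
        by (intro cong_sum red s) auto
      then show ?thesis
        by (simp add: cong_def mod_mult_right_eq sum_distrib_left mult.assoc)
    qed
    then show ?thesis
      using cyc_sum_smult_closed[of L a x] x
      by (simp add: mat_map_def) (auto simp: cyc_sum_def intro!: restrict_ext)
  qed
  show ?thesis using 1 2 3 by (auto simp: linear_maps_def)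
qed

lemma mat_of_mat_map:
  assumes "r < length L" "s < length N"
    "int p ^ (N ! s - L ! r) dvd A r s"
  shows "[mat_of p L (mat_map p L N A) r s = A r s] (mod int p ^ (N ! s))"
proof -
  have "(\<Sum>k<length L. unit_elt p L r k * A k s) = (\<Sum>k<length L. if k = r then (1 mod int p ^ (L ! r)) * A r s else 0)"
    by (intro sum.cong) (auto simp: unit_elt_def)
  also have "\<dots> = (1 mod int p ^ (L ! r)) * A r s"
    using assms(1) by simp
  also have "[\<dots> = A r s] (mod int p ^ (N ! s))"
  \<comment> \<open>If the summand is trivial, \<open>1 mod 1 = 0\<close>, so
    \<open>unit_elt\<close> vanishes there; the entry must then itself be zero modulo
    \<open>p ^ (N ! s)\<close>, which is what the divisibility says.\<close>
  proof (cases "L ! r = 0")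
    case True
    then show ?thesis using assms by (auto simp: cong_iff_dvd_diff)
  next
    case False
    then show ?thesis using p one_less_power[of "int p" "L ! r"] by simp
  qed
  finally show ?thesis
    using assms by (simp add: mat_of_def mat_map_def unit_elt_closed)
qed

lemma linear_map_zero:
  assumes "f \<in> linear_maps (residue_ring (int p ^ m)) (cyc_sum p L) (cyc_sum p N)"
  shows "f \<zero>\<^bsub>cyc_sum p L\<^esub> = \<zero>\<^bsub>cyc_sum p N\<^esub>"
proof -
  have z: "0 \<odot>\<^bsub>cyc_sum p K\<^esub> x = \<zero>\<^bsub>cyc_sum p K\<^esub>" for K x
    by (auto simp: cyc_sum_def)
  have "0 \<in> carrier (residue_ring (int p ^ m))"
    using p by (simp add: residue_ring_def)
  then have "f (0 \<odot>\<^bsub>cyc_sum p L\<^esub> \<zero>\<^bsub>cyc_sum p L\<^esub>) = 0 \<odot>\<^bsub>cyc_sum p N\<^esub> f \<zero>\<^bsub>cyc_sum p L\<^esub>"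
    using assms cyc_sum_zero_closed by (auto simp: linear_maps_def)
  then show ?thesis by (simp add: z)
qed

lemma linear_map_apply:
  assumes f: "f \<in> linear_maps (residue_ring (int p ^ m)) (cyc_sum p L) (cyc_sum p N)"
    and L: "L \<in> Ob (mod_category p m)" and x: "x \<in> carrier (cyc_sum p L)" and s: "s < length N"
  shows "[f x s = (\<Sum>t<length L. x t * mat_of p L f t s)] (mod int p ^ (N ! s))"
proof -
  \<comment> \<open>The truncations of \<open>x\<close> to its first \<open>k\<close> coordinates;
    adding one coordinate at a time turns additivity into the sum over unit elements.\<close>
  define tr where "tr k = (\<lambda>i\<in>{..<length L}. if i < k then x i else 0)" for k
  have trc: "tr k \<in> carrier (cyc_sum p L)" for k
    using x p by (auto simp: carrier_cyc_sum_iff tr_def)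
  have "k \<le> length L \<Longrightarrow> [f (tr k) s = (\<Sum>t<k. x t * mat_of p L f t s)] (mod int p ^ (N ! s))" for k
  proof (induction k)
    case 0
    have "tr 0 = \<zero>\<^bsub>cyc_sum p L\<^esub>" by (auto simp: tr_def cyc_sum_def)
    then have "f (tr 0) s = 0" using linear_map_zero[OF f] s by (simp add: cyc_sum_def)
    then show ?case by simp
  next
    case (Suc k)
    then have k: "k < length L" by simp
    have xk: "0 \<le> x k" "x k < int p ^ (L ! k)" and xb: "\<And>i. i < length L \<Longrightarrow> 0 \<le> x i \<and> x i < int p ^ (L ! i)"
      using x k by (auto simp: carrier_cyc_sum_iff)
    \<comment> \<open>The exponents are at most \<open>m\<close>, so the coordinate
      \<open>x k\<close> is itself a scalar in the carrier of the residue ring.\<close>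
    have "L ! k \<le> m" using L k by (rule nth_Ob_mod_category)
    then have "int p ^ (L ! k) \<le> int p ^ m" using p by (intro power_increasing) auto
    then have R: "x k \<in> carrier (residue_ring (int p ^ m))"
      using xk by (simp add: residue_ring_def)
    let ?y = "x k \<odot>\<^bsub>cyc_sum p L\<^esub> unit_elt p L k"
    have "tr (Suc k) = tr k \<oplus>\<^bsub>cyc_sum p L\<^esub> ?y"
      using xb k by (auto simp: tr_def cyc_sum_def unit_elt_def fun_eq_iff restrict_def less_Suc_eq mod_mult_right_eq)
    then have "f (tr (Suc k)) = f (tr k) \<oplus>\<^bsub>cyc_sum p N\<^esub> f ?y"
      using f trc cyc_sum_smult_closed by (auto simp: linear_maps_def)
    also have "f ?y = x k \<odot>\<^bsub>cyc_sum p N\<^esub> f (unit_elt p L k)"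
      using f R unit_elt_closed by (auto simp: linear_maps_def)
    finally have "f (tr (Suc k)) s = (f (tr k) s + x k * f (unit_elt p L k) s) mod int p ^ (N ! s)"
      using s by (simp add: cyc_sum_def mod_add_right_eq)
    then have "[f (tr (Suc k)) s = f (tr k) s + x k * mat_of p L f k s] (mod int p ^ (N ! s))"
      by (simp add: mat_of_def)
    also have "[f (tr k) s + x k * mat_of p L f k s = (\<Sum>t<k. x t * mat_of p L f t s) + x k * mat_of p L f k s]
        (mod int p ^ (N ! s))"
      using Suc by (intro cong_add) auto
    finally show ?case by simp
  qed
  moreover have "tr (length L) = x"
    using x by (auto simp: carrier_cyc_sum_iff tr_def extensional_def fun_eq_iff)
  ultimately show ?thesis by (metis order_refl)
qed

lemma mat_of_compose:
  assumes f: "f \<in> Hom (mod_category p m) L M" and g: "g \<in> Hom (mod_category p m) M N"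
    and M: "M \<in> Ob (mod_category p m)" and s: "s < length N"
  shows "[mat_of p L (Comp (mod_category p m) L M N f g) r s =
           (\<Sum>t<length M. mat_of p L f r t * mat_of p M g t s)] (mod int p ^ (N ! s))"
  using linear_map_apply[OF _ M Hom_apply_closed[OF f unit_elt_closed] s, of g] g
  by (simp add: mat_of_def compose_def unit_elt_closed)

text \<open>Since \<open>p ^ (L ! r)\<close> annihilates the generator of the source summand, it
  annihilates its image. This is the converse of the condition in
  \<open>mat_map_linear\<close>.\<close>

lemma mat_of_dvd:
  assumes f: "f \<in> Hom (mod_category p m) L N"
    and N: "N \<in> Ob (mod_category p m)" and r: "r < length L" and s: "s < length N"
  shows "int p ^ (N ! s - L ! r) dvd mat_of p L f r s"
\<comment> \<open>Here \<open>L ! r < N ! s <= m\<close>, so \<open>p ^ (L ! r)\<close> is a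
  legitimate scalar; otherwise the truncated exponent is \<open>0\<close>.\<close>
proof (cases "L ! r < N ! s")
  case True
  moreover have "N ! s \<le> m" using N s by (rule nth_Ob_mod_category)
  ultimately have "int p ^ (L ! r) \<in> carrier (residue_ring (int p ^ m))"
    using p by (simp add: residue_ring_def)
  then have "f (int p ^ (L ! r) \<odot>\<^bsub>cyc_sum p L\<^esub> unit_elt p L r) =
      int p ^ (L ! r) \<odot>\<^bsub>cyc_sum p N\<^esub> f (unit_elt p L r)"
    using f unit_elt_closed by (auto simp: linear_maps_def)
  moreover have "int p ^ (L ! r) \<odot>\<^bsub>cyc_sum p L\<^esub> unit_elt p L r = \<zero>\<^bsub>cyc_sum p L\<^esub>"
    by (auto simp: cyc_sum_def unit_elt_def fun_eq_iff restrict_def)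
  ultimately have "\<zero>\<^bsub>cyc_sum p N\<^esub> s = (int p ^ (L ! r) \<odot>\<^bsub>cyc_sum p N\<^esub> f (unit_elt p L r)) s"
    using linear_map_zero f by auto
  then have "int p ^ (N ! s) dvd int p ^ (L ! r) * mat_of p L f r s"
    using s by (simp add: cyc_sum_def mat_of_def mod_eq_0_iff_dvd)
  moreover have "int p ^ (N ! s) = int p ^ (L ! r) * int p ^ (N ! s - L ! r)"
    using True by (simp flip: power_add)
  ultimately show ?thesis using p by simp
qed simp

section \<open>Stable morphisms\<close>

text \<open>Parallel maps from or to the zero module agree, so every lifting or extension problem is
  solved by a zero map. This supplies the bijective object over which zero maps factor.\<close>

lemma bijective_in_Nil: "bijective_in (mod_category p m) []"
proof -
  have single: "carrier (cyc_sum p []) = {\<zero>\<^bsub>cyc_sum p []\<^esub>}"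
    by (auto simp: cyc_sum_def restrict_def)
  have ne: "mat_map p L N (\<lambda>_ _. 0) \<in> Hom (mod_category p m) L N" for L N
    by (simp add: mat_map_linear)
  have comp: "compose (carrier (cyc_sum p L)) g f \<in> Hom (mod_category p m) L N"
    if "f \<in> Hom (mod_category p m) L M" "g \<in> Hom (mod_category p m) M N" for f g L M N
    using Hom_comp_closed that by simp
  have from_Nil: "f = g" if "f \<in> Hom (mod_category p m) [] N" "g \<in> Hom (mod_category p m) [] N" for f g N
    using that by (auto simp: single linear_map_zero intro!: linear_maps_eqI[of f _ _ _ g])
  have to_Nil: "f = g" if f: "f \<in> Hom (mod_category p m) L []" and g: "g \<in> Hom (mod_category p m) L []" for f g L
  proof -
    have "f x = g x" if "x \<in> carrier (cyc_sum p L)" for x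
      using Hom_apply_closed[OF f that] Hom_apply_closed[OF g that]
      by (simp add: single)
    then show ?thesis using f g by (auto intro!: linear_maps_eqI[of f _ _ _ g])
  qed
  have "projective_in (mod_category p m) []"
    unfolding projective_in_def epi_in_def
    by (auto simp del: mod_category_simps(2) intro!: bexI[OF _ ne] from_Nil comp ne)
  moreover have "injective_in (mod_category p m) []"
    unfolding injective_in_def mono_in_def
    by (auto simp del: mod_category_simps(2) intro!: bexI[OF _ ne] to_Nil comp ne)
  ultimately show ?thesis by (simp add: bijective_in_def)
qed

text \<open>The zero map factors over \<open>[]\<close>, and \<open>f\<close> plus zero is
  \<open>f\<close>. Hence every map lies in its own class, so classes have representatives.\<close>

lemma stable_eq_refl:
  assumes f: "f \<in> Hom (mod_category p m) L N"
  shows "(f, f) \<in> stable_eq (mod_category p m) L N"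
proof -
  let ?E = "mod_category p m"
  let ?u = "mat_map p L [] (\<lambda>_ _. 0)" and ?v = "mat_map p [] N (\<lambda>_ _. 0)"
  have uv: "?u \<in> Hom ?E L []" "?v \<in> Hom ?E [] N" by (simp_all add: mat_map_linear)
  have "f x \<oplus>\<^bsub>cyc_sum p N\<^esub> ?v (?u x) = f x" if x: "x \<in> carrier (cyc_sum p L)" for x
  proof -
    have "?u x \<in> carrier (cyc_sum p [])" by (rule Hom_apply_closed[OF uv(1) x])
    then have "?v (?u x) = \<zero>\<^bsub>cyc_sum p N\<^esub>" by (simp add: mat_map_def) (simp add: cyc_sum_def)
    moreover have "f x \<in> carrier (cyc_sum p N)" by (rule Hom_apply_closed[OF f x])
    ultimately show ?thesis
      unfolding carrier_cyc_sum_iff by (auto simp: cyc_sum_def fun_eq_iff extensional_def)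
  qed
  then have "f = Plus ?E L N f (Comp ?E L [] N ?u ?v)"
    using f by (auto simp: mod_category_def compose_def linear_maps_def PiE_iff extensional_def fun_eq_iff)
  then show ?thesis
    using bijective_in_Nil f uv unfolding stable_eq_def by blast
qed

text \<open>
  A map to \<open>N\<close> that factors over a projective object also factors over the epimorphism from a
  sum of copies of \<open>\<int>/p\<^sup>m\<close> to \<open>N\<close>.
\<close>

lemma mat_of_factors_projective:
  assumes L: "L \<in> Ob (mod_category p m)" and N: "N \<in> Ob (mod_category p m)"
    and b: "projective_in (mod_category p m) b"
    and u: "u \<in> Hom (mod_category p m) L b" and v: "v \<in> Hom (mod_category p m) b N"
    and r: "r < length L" and s: "s < length N"
  shows "int p ^ min (m - L ! r) (N ! s) dvd mat_of p L (Comp (mod_category p m) L b N u v) r s"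
proof -
  let ?E = "mod_category p m"
  define P where "P = replicate (length N) m"
  define e where "e = mat_map p P N (\<lambda>r s. if r = s then 1 else 0)"
  have Nm: "N ! k \<le> m" if "k < length N" for k
    using N that by (rule nth_Ob_mod_category)
  have P: "P \<in> Ob ?E" by (auto simp: P_def)
  have e: "e \<in> Hom ?E P N"
    using Nm by (auto simp: e_def P_def intro!: mat_map_linear)
  have e_apply: "e x k = x k mod int p ^ (N ! k)" if "x \<in> carrier (cyc_sum p P)" "k < length N" for x k
    using that by (simp add: e_def mat_map_def P_def if_distrib[of "(*) _"] cong: if_cong)
  \<comment> \<open>The family of reduced residues \<open>y\<close> is its own preimage under the
    cover, as residues modulo \<open>p ^ (N ! k)\<close> are also residues modulo
    \<open>p ^ m\<close>.\<close>
  have surj: "y \<in> carrier (cyc_sum p P) \<and> e y = y" if y: "y \<in> carrier (cyc_sum p N)" for y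
  proof -
    have "int p ^ (N ! k) \<le> int p ^ m" if "k < length N" for k
      using p Nm[OF that] by (intro power_increasing) auto
    then have yP: "y \<in> carrier (cyc_sum p P)"
      using y by (force simp: carrier_cyc_sum_iff P_def)
    then have "e y \<in> carrier (cyc_sum p N)" by (rule Hom_apply_closed[OF e])
    then have "e y = y"
      using y e_apply[OF yP] by (intro extensionalityI[of _ "{..<length N}"]) (auto simp: carrier_cyc_sum_iff)
    with yP show ?thesis by simp
  qed
  have "epi_in ?E P N e"
    unfolding epi_in_def
  proof (intro conjI ballI impI e)
    fix t g h assume g: "g \<in> Hom ?E N t" and h: "h \<in> Hom ?E N t"
      and eq: "Comp ?E P N t e g = Comp ?E P N t e h"
    have "g y = h y" if "y \<in> carrier (cyc_sum p N)" for y
      using fun_cong[OF eq, of y] surj[OF that] by (simp add: compose_def)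
    then show "g = h" using g h by (auto intro!: linear_maps_eqI[of g _ _ _ h])
  qed
  then obtain h where h: "h \<in> Hom ?E b P" and hv: "Comp ?E b P N h e = v"
    using b N P v unfolding projective_in_def by blast
  let ?w = "Comp ?E L b P u h"
  have w: "?w \<in> Hom ?E L P"
    by (rule Hom_comp_closed[OF u h])
  \<comment> \<open>All summands of \<open>P\<close> have exponent \<open>m\<close>, so linearity
    alone forces this divisibility.\<close>
  have *: "int p ^ (m - L ! r) dvd mat_of p L ?w r s"
    using mat_of_dvd[OF w P r, of s] s by (simp add: P_def)
  let ?x = "unit_elt p L r"
  have x: "?x \<in> carrier (cyc_sum p L)" by (rule unit_elt_closed)
  have ux: "u ?x \<in> carrier (cyc_sum p b)" by (rule Hom_apply_closed[OF u x])
  have "v (u ?x) = e (h (u ?x))"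
    using fun_cong[OF hv, of "u ?x"] ux by (simp add: compose_def)
  then have "mat_of p L (Comp ?E L b N u v) r s = mat_of p L ?w r s mod int p ^ (N ! s)"
    using e_apply[OF Hom_apply_closed[OF h ux] s] x by (simp add: mat_of_def compose_def)
  also have "int p ^ min (m - L ! r) (N ! s) dvd \<dots>"
    by (rule dvd_mod[OF dvd_trans[OF _ *]]) (simp_all add: le_imp_power_dvd)
  finally show ?thesis .
qed

text \<open>The difference of \<open>f\<close> and \<open>g\<close> factors over a bijective, hence
  projective, object. So a matrix entry modulo this power of \<open>p\<close> is an invariant of the
  stable morphism.\<close>

lemma stable_eq_cong:
  assumes L: "L \<in> Ob (mod_category p m)" and N: "N \<in> Ob (mod_category p m)"
    and fg: "(f, g) \<in> stable_eq (mod_category p m) L N" and r: "r < length L" and s: "s < length N"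
  shows "[mat_of p L f r s = mat_of p L g r s] (mod int p ^ min (m - L ! r) (N ! s))"
proof -
  let ?E = "mod_category p m"
  obtain b u v where b: "bijective_in ?E b" and uv: "u \<in> Hom ?E L b" "v \<in> Hom ?E b N"
    and g: "g = Plus ?E L N f (Comp ?E L b N u v)"
    using fg by (auto simp: stable_eq_def)
  let ?h = "mat_of p L (Comp ?E L b N u v) r s" and ?q = "int p ^ min (m - L ! r) (N ! s)"
  have "[?h = 0] (mod ?q)"
    using mat_of_factors_projective[OF L N _ uv r s] b by (simp add: bijective_in_def cong_0_iff)
  have "mat_of p L g r s = (mat_of p L f r s + ?h) mod int p ^ (N ! s)"
    using s unit_elt_closed by (simp add: g mat_of_def) (simp add: mod_category_def cyc_sum_def)
  then have "[mat_of p L g r s = mat_of p L f r s + ?h] (mod int p ^ (N ! s))"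
    by simp
  then have "[mat_of p L g r s = mat_of p L f r s + ?h] (mod ?q)"
    by (rule cong_dvd_modulus) (simp add: le_imp_power_dvd)
  also have "[mat_of p L f r s + ?h = mat_of p L f r s + 0] (mod ?q)"
    using \<open>[?h = 0] (mod ?q)\<close> by (intro cong_add) auto
  finally show ?thesis by (simp add: cong_sym)
qed

text \<open>Write \<open>a * b - a' * b' = (a - a') * b + a' * (b - b')\<close>, for entries from
  exponent \<open>l\<close> via \<open>k\<close> to \<open>j\<close>. In each summand one factor is
  a stable difference and the other carries the power of \<open>p\<close> required by linearity;
  together the exponents reach \<open>min (m - l) j\<close>.\<close>

lemma cong_mult_stable:
  fixes a a' b b' :: int
  assumes "[a = a'] (mod int p ^ min (m - l) k)" "[b = b'] (mod int p ^ min (m - k) j)"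
    and "int p ^ (k - l) dvd a'" "int p ^ (j - k) dvd b"
  shows "[a * b = a' * b'] (mod int p ^ min (m - l) j)"
proof -
  let ?q = "int p ^ min (m - l) j"
  have "?q dvd int p ^ (min (m - l) k + (j - k))" by (rule le_imp_power_dvd) auto
  also have "\<dots> dvd (a - a') * b"
    unfolding power_add using assms by (intro mult_dvd_mono) (auto simp: cong_iff_dvd_diff)
  finally have 1: "?q dvd (a - a') * b" .
  have "?q dvd int p ^ ((k - l) + min (m - k) j)" by (rule le_imp_power_dvd) auto
  also have "\<dots> dvd a' * (b - b')"
    unfolding power_add using assms by (intro mult_dvd_mono) (auto simp: cong_iff_dvd_diff)
  finally have "?q dvd (a - a') * b + a' * (b - b')" using 1 by (simp add: dvd_add)
  then show ?thesis by (simp add: cong_iff_dvd_diff algebra_simps)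
qed

section \<open>Stable morphisms computed on representatives\<close>

lemma stable_mod_simps:
  "Hom (stable_mod p m) L N = Hom (mod_category p m) L N // stable_eq (mod_category p m) L N"
  "Comp (stable_mod p m) L M N F G =
     (\<Union>f\<in>F. \<Union>g\<in>G. stable_eq (mod_category p m) L N `` {Comp (mod_category p m) L M N f g})"
  "Id (stable_mod p m) L = stable_eq (mod_category p m) L L `` {Id (mod_category p m) L}"
  "Sh_ob (stable_mod p m) = shift_obj m"
  "Sh_mor (stable_mod p m) L N F = (\<Union>f\<in>F.
         stable_eq (mod_category p m) (shift_obj m L) (shift_obj m N) `` {shift_map p m L N f})"
  by (simp_all add: stable_mod_def stable_category_def additive_category.defs)

lemma stable_hom_memD:
  "F \<in> Hom (stable_mod p m) L N \<Longrightarrow> f \<in> F \<Longrightarrow> f \<in> Hom (mod_category p m) L N"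
  by (auto simp: stable_mod_simps quotient_def stable_eq_def)

lemma stable_hom_nonempty:
  "F \<in> Hom (stable_mod p m) L N \<Longrightarrow> \<exists>f. f \<in> F"
  using stable_eq_refl by (fastforce simp: stable_mod_simps(1) quotient_def)

lemma stable_hom_cong:
  assumes "L \<in> Ob (mod_category p m)" "N \<in> Ob (mod_category p m)"
    and "F \<in> Hom (stable_mod p m) L N" "f \<in> F" "g \<in> F" "r < length L" "s < length N"
  shows "[mat_of p L f r s = mat_of p L g r s] (mod int p ^ min (m - L ! r) (N ! s))"
proof -
  obtain h where h: "(h, f) \<in> stable_eq (mod_category p m) L N" "(h, g) \<in> stable_eq (mod_category p m) L N"
    using assms by (auto simp: stable_mod_simps quotient_def)
  show ?thesis
    using cong_trans[OF cong_sym stable_eq_cong[OF assms(1,2) h(2) assms(6,7)]]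
      stable_eq_cong[OF assms(1,2) h(1) assms(6,7)] by blast
qed

lemma stable_comp_mem:
  assumes "F \<in> Hom (stable_mod p m) L M" "G \<in> Hom (stable_mod p m) M N" "f \<in> F" "g \<in> G"
  shows "Comp (mod_category p m) L M N f g \<in> Comp (stable_mod p m) L M N F G"
proof -
  have "Comp (mod_category p m) L M N f g \<in> Hom (mod_category p m) L N"
    by (rule Hom_comp_closed[OF stable_hom_memD[OF assms(1,3)] stable_hom_memD[OF assms(2,4)]])
  from stable_eq_refl[OF this] show ?thesis
    using assms(3,4) unfolding stable_mod_simps by blast
qed

text \<open>By definition \<open>h\<close> is stably equal to a composite of some representatives;
  \<open>cong_mult_stable\<close> exchanges these for \<open>f\<close> and \<open>g\<close> term by
  term.\<close>

lemma stable_comp_cong: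
  assumes L: "L \<in> Ob (mod_category p m)" and M: "M \<in> Ob (mod_category p m)"
    and N: "N \<in> Ob (mod_category p m)"
    and F: "F \<in> Hom (stable_mod p m) L M" and G: "G \<in> Hom (stable_mod p m) M N"
    and f: "f \<in> F" and g: "g \<in> G" and h: "h \<in> Comp (stable_mod p m) L M N F G"
    and r: "r < length L" and s: "s < length N"
  shows "[mat_of p L h r s = (\<Sum>t<length M. mat_of p L f r t * mat_of p M g t s)]
           (mod int p ^ min (m - L ! r) (N ! s))"
proof -
  let ?E = "mod_category p m"
  obtain f' g' where f': "f' \<in> F" and g': "g' \<in> G"
    and h': "(Comp ?E L M N f' g', h) \<in> stable_eq ?E L N"
    using h by (auto simp: stable_mod_simps simp del: mod_category_simps)
  have "[mat_of p L h r s = mat_of p L (Comp ?E L M N f' g') r s] (mod int p ^ min (m - L ! r) (N ! s))"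
    using stable_eq_cong[OF L N h' r s] by (rule cong_sym)
  also have "[mat_of p L (Comp ?E L M N f' g') r s = (\<Sum>t<length M. mat_of p L f' r t * mat_of p M g' t s)]
      (mod int p ^ min (m - L ! r) (N ! s))"
    using mat_of_compose[OF stable_hom_memD[OF F f'] stable_hom_memD[OF G g'] M s]
    by (rule cong_dvd_modulus) (simp add: le_imp_power_dvd)
  also have "[(\<Sum>t<length M. mat_of p L f' r t * mat_of p M g' t s) =
      (\<Sum>t<length M. mat_of p L f r t * mat_of p M g t s)] (mod int p ^ min (m - L ! r) (N ! s))"
  proof (rule cong_sum, rule cong_mult_stable)
    fix t assume "t \<in> {..<length M}"
    then have t: "t < length M" by simp
    show "[mat_of p L f' r t = mat_of p L f r t] (mod int p ^ min (m - L ! r) (M ! t))"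
      by (rule stable_hom_cong[OF L M F f' f r t])
    show "[mat_of p M g' t s = mat_of p M g t s] (mod int p ^ min (m - M ! t) (N ! s))"
      by (rule stable_hom_cong[OF M N G g' g t s])
    show "int p ^ (M ! t - L ! r) dvd mat_of p L f r t"
      by (rule mat_of_dvd[OF stable_hom_memD[OF F f] M r t])
    show "int p ^ (N ! s - M ! t) dvd mat_of p M g' t s"
      by (rule mat_of_dvd[OF stable_hom_memD[OF G g'] N t s])
  qed
  finally show ?thesis .
qed

text \<open>The composite of representatives along one side also lies in the class along the other
  side, so both matrix products are congruent to its entries.\<close>

lemma stable_square_cong:
  assumes Ob: "K \<in> Ob (mod_category p m)" "L \<in> Ob (mod_category p m)"
      "M \<in> Ob (mod_category p m)" "N \<in> Ob (mod_category p m)"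
    and F: "F \<in> Hom (stable_mod p m) K L" and G: "G \<in> Hom (stable_mod p m) L N"
    and F': "F' \<in> Hom (stable_mod p m) K M" and G': "G' \<in> Hom (stable_mod p m) M N"
    and mem: "f \<in> F" "g \<in> G" "f' \<in> F'" "g' \<in> G'"
    and eq: "Comp (stable_mod p m) K L N F G = Comp (stable_mod p m) K M N F' G'"
    and r: "r < length K" and s: "s < length N"
  shows "[(\<Sum>t<length L. mat_of p K f r t * mat_of p L g t s) =
          (\<Sum>t<length M. mat_of p K f' r t * mat_of p M g' t s)] (mod int p ^ min (m - K ! r) (N ! s))"
proof -
  let ?h = "Comp (mod_category p m) K L N f g"
  have h: "?h \<in> Comp (stable_mod p m) K L N F G" by (rule stable_comp_mem[OF F G mem(1,2)])
  note 1 = stable_comp_cong[OF Ob(1,2,4) F G mem(1,2) h r s]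
  note 2 = stable_comp_cong[OF Ob(1,3,4) F' G' mem(3,4) h[unfolded eq] r s]
  show ?thesis using cong_trans[OF cong_sym[OF 1] 2] .
qed

lemma mat_class_mem:
  assumes "\<And>r s. r < length L \<Longrightarrow> s < length N \<Longrightarrow> int p ^ (N ! s - L ! r) dvd A ! r ! s"
  shows "mat_map p L N (\<lambda>r s. A ! r ! s) \<in> mat_class p m L N A"
    and "mat_class p m L N A \<in> Hom (stable_mod p m) L N"
proof -
  have hom: "mat_map p L N (\<lambda>r s. A ! r ! s) \<in> Hom (mod_category p m) L N"
    using assms by (simp add: mat_map_linear)
  show "mat_map p L N (\<lambda>r s. A ! r ! s) \<in> mat_class p m L N A"
    using stable_eq_refl[OF hom] unfolding mat_class_def by blast
  show "mat_class p m L N A \<in> Hom (stable_mod p m) L N"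
    using hom unfolding mat_class_def stable_mod_simps by (rule quotientI)
qed

text \<open>The form needed for two diagrams with the same objects: the arrows have explicit
  matrices, whose entries replace those of the associated maps by \<open>mat_of_mat_map\<close> and
  \<open>cong_mult_stable\<close>.\<close>

lemma stable_square_mat_class:
  assumes K: "K \<in> Ob (mod_category p m)" and M: "M \<in> Ob (mod_category p m)"
    and F: "F \<in> Hom (stable_mod p m) K K" and F': "F' \<in> Hom (stable_mod p m) M M"
    and f: "f \<in> F" and f': "f' \<in> F'"
    and A: "\<And>r s. r < length K \<Longrightarrow> s < length M \<Longrightarrow> int p ^ (M ! s - K ! r) dvd A ! r ! s"
    and B: "\<And>r s. r < length K \<Longrightarrow> s < length M \<Longrightarrow> int p ^ (M ! s - K ! r) dvd B ! r ! s"
    and eq: "Comp (stable_mod p m) K K M F (mat_class p m K M A) =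
      Comp (stable_mod p m) K M M (mat_class p m K M B) F'"
    and r: "r < length K" and s: "s < length M"
  shows "[(\<Sum>t<length K. mat_of p K f r t * A ! t ! s) =
          (\<Sum>t<length M. B ! r ! t * mat_of p M f' t s)] (mod int p ^ min (m - K ! r) (M ! s))"
proof -
  let ?q = "int p ^ min (m - K ! r) (M ! s)"
  let ?A = "mat_of p K (mat_map p K M (\<lambda>r s. A ! r ! s))"
  let ?B = "mat_of p K (mat_map p K M (\<lambda>r s. B ! r ! s))"
  have weaken: "[x = y] (mod int p ^ min k l)" if "[x = y] (mod int p ^ l)" for x y k l
    using that by (rule cong_dvd_modulus) (simp add: le_imp_power_dvd)
  have "[(\<Sum>t<length K. mat_of p K f r t * A ! t ! s) = (\<Sum>t<length K. mat_of p K f r t * ?A t s)] (mod ?q)"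
  proof (rule cong_sum, rule cong_mult_stable)
    fix t assume "t \<in> {..<length K}"
    then have t: "t < length K" by simp
    show "[A ! t ! s = ?A t s] (mod int p ^ min (m - K ! t) (M ! s))"
      using mat_of_mat_map[where A = "\<lambda>r s. A ! r ! s", OF t s A[OF t s]]
      by (rule weaken[OF cong_sym])
    show "int p ^ (K ! t - K ! r) dvd mat_of p K f r t"
      by (rule mat_of_dvd[OF stable_hom_memD[OF F f] K r t])
    show "int p ^ (M ! s - K ! t) dvd A ! t ! s" using t s by (rule A)
  qed simp
  also have "[(\<Sum>t<length K. mat_of p K f r t * ?A t s) = (\<Sum>t<length M. ?B r t * mat_of p M f' t s)] (mod ?q)"
    by (rule stable_square_cong[OF K K M M F mat_class_mem(2)[OF A] mat_class_mem(2)[OF B] F'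
          f mat_class_mem(1)[OF A] mat_class_mem(1)[OF B] f' eq r s])
  also have "[(\<Sum>t<length M. ?B r t * mat_of p M f' t s) = (\<Sum>t<length M. B ! r ! t * mat_of p M f' t s)] (mod ?q)"
  proof (rule cong_sum, rule cong_mult_stable)
    fix t assume "t \<in> {..<length M}"
    then have t: "t < length M" by simp
    show "[?B r t = B ! r ! t] (mod int p ^ min (m - K ! r) (M ! t))"
      using mat_of_mat_map[where A = "\<lambda>r s. B ! r ! s", OF r t B[OF r t]] by (rule weaken)
    show "int p ^ (M ! t - K ! r) dvd B ! r ! t" using r t by (rule B)
    show "int p ^ (M ! s - M ! t) dvd mat_of p M f' t s"
      by (rule mat_of_dvd[OF stable_hom_memD[OF F' f'] M t s])
  qed simp
  finally show ?thesis .
qed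

text \<open>For \<open>m = 2 * n\<close> the shift fixes \<open>[n]\<close>, and the factor in
  \<open>shift_entry\<close> is \<open>p ^ 0\<close>.\<close>

lemma mat_of_shift_map:
  assumes F: "F \<in> Hom (stable_mod p (2 * n)) [n] [n]" and f: "f \<in> F"
    and h: "h \<in> Sh_mor (stable_mod p (2 * n)) [n] [n] F"
  shows "[mat_of p [n] h 0 0 = mat_of p [n] f 0 0] (mod int p ^ n)"
proof -
  have [simp]: "shift_obj (2 * n) [n] = [n]" by (simp add: shift_obj_def)
  have Ob: "[n] \<in> Ob (mod_category p (2 * n))" by simp
  obtain g where g: "g \<in> F"
    and gh: "(shift_map p (2 * n) [n] [n] g, h) \<in> stable_eq (mod_category p (2 * n)) [n] [n]"
    using h by (auto simp: stable_mod_simps simp del: mod_category_simps)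
  have "[mat_of p [n] h 0 0 = mat_of p [n] (shift_map p (2 * n) [n] [n] g) 0 0] (mod int p ^ n)"
    using stable_eq_cong[OF Ob Ob gh, of 0 0] by (simp add: cong_sym)
  also have "[mat_of p [n] (shift_map p (2 * n) [n] [n] g) 0 0 = mat_of p [n] g 0 0] (mod int p ^ n)"
    unfolding shift_map_def
    using mat_of_mat_map[of 0 "[n]" 0 "[n]" "\<lambda>r s. shift_entry p n n (mat_of p [n] g 0 0)"]
    by (simp add: shift_entry_def mat_of_def mat_map_def unit_elt_closed unit_elt_def)
  also have "[mat_of p [n] g 0 0 = mat_of p [n] f 0 0] (mod int p ^ n)"
    using stable_hom_cong[OF Ob Ob F g f, of 0 0] by simp
  finally show ?thesis .
qed

end

section \<open>The diagrams\<close>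

lemma dob_matrix_diagram [simp]:
  "dob (matrix_diagram p n num den) = ext_ob (stable_mod p (2 * n)) (base_ob n)"
  by (simp add: matrix_diagram_def periodic_extension_def Let_def)

text \<open>The index difference is one, so \<open>ext_path\<close> consists of a single step, and
  \<open>goes_num\<close> selects the numerator.\<close>

lemma darr_matrix_diagram_num:
  assumes "i \<le> j" "j \<le> n"
  shows "darr (matrix_diagram p n num den) ((j, 0), (i, 0)) (sym_succ n (j, 0), (i, 0)) =
    mat_class p (2 * n) (base_ob n j i)
      (ext_ob (stable_mod p (2 * n)) (base_ob n) (sym_succ n (j, 0), (i, 0))) (num j i)"
  using assms
  by (auto simp: matrix_diagram_def periodic_extension_def Let_def sym_index_def sym_succ_def
      ext_step_def goes_num_def ext_num_def sym_le_def sym_shift_def)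

lemma darr_matrix_diagram_den:
  assumes "i < j" "j \<le> n"
  shows "darr (matrix_diagram p n num den) ((j, 0), (i, 0)) ((j, 0), (i + 1, 0)) =
    mat_class p (2 * n) (base_ob n j i) (base_ob n j (i + 1)) (den j i)"
  using assms
  by (auto simp: matrix_diagram_def periodic_extension_def Let_def sym_index_def sym_succ_def
      ext_step_def goes_num_def ext_den_def sym_le_def sym_shift_def)

lemma strip_base: "i \<le> j \<Longrightarrow> j \<le> n \<Longrightarrow> ((j, 0), (i, 0)) \<in> strip n"
  by (auto simp: strip_def sym_set_def sym_le_def sym_shift_def)

lemma strip_wrap: "i \<le> n \<Longrightarrow> ((0, 1), (i, 0)) \<in> strip n"
  by (auto simp: strip_def sym_set_def sym_le_def sym_shift_def)

section \<open>The arithmetic of the congruences\<close>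

text \<open>The assumption \<open>A\<close> comes from the squares along \<open>j/0\<close>,
  \<open>top\<close> from \<open>n/0\<close> to \<open>n/1\<close>, \<open>c\<close>,
  \<open>d\<close>, \<open>dn\<close> and \<open>en\<close> from those along \<open>j/1\<close>,
  \<open>c2\<close> from linearity at \<open>2/1\<close>, \<open>bot\<close> and \<open>bot'\<close>
  from \<open>n/1\<close> to the shift of \<open>0\<close> over \<open>1\<close>. Each cancellation
  of \<open>P\<close> costs one power of the modulus.\<close>

lemma p_dvd_endomorphism:
  fixes P :: int and A b c d e :: "nat \<Rightarrow> int"
  assumes P: "P > 1" and n: "n \<ge> 3"
    and A: "\<And>j. 1 \<le> j \<Longrightarrow> j < n \<Longrightarrow> [A j * P = P * A (j + 1)] (mod P ^ n)"
    and top: "[A n = b n + P * d n] (mod P ^ (n - 1))"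
    and c: "\<And>j. 2 \<le> j \<Longrightarrow> j < n \<Longrightarrow> [c j = P * c (j + 1)] (mod P ^ (2 * n - j))"
    and d: "\<And>j. 2 \<le> j \<Longrightarrow> j < n - 1 \<Longrightarrow> [d j * P = d (j + 1)] (mod P ^ (j - 1))"
    and dn: "[d (n - 1) * P + e (n - 1) * P ^ (n - 3) = d n] (mod P ^ (n - 2))"
    and en: "[e (n - 1) = e n] (mod P ^ (n - 2))"
    and c2: "P ^ (2 * n - 2) dvd c 2"
    and bot: "[b n * (- P) + c n = - P * A 1] (mod P ^ n)"
    and bot': "[d n * (- P) + e n = A 1] (mod P ^ (n - 1))"
  shows "P dvd A 1"
proof -
  have P0: "P \<noteq> 0" using P by simp
  have cancel: "P ^ k dvd x" if "P ^ Suc k dvd P * x" for k x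
    using that P0 by simp
  have le: "P ^ k dvd x" if "P ^ l dvd x" "k \<le> l" for k l x
    using that le_imp_power_dvd dvd_trans by blast
  \<comment> \<open>Each step to the right divides by \<open>P\<close>; starting from
    \<open>2 * n - 2\<close> at \<open>j = 2\<close>, exactly \<open>P ^ n\<close> is left at
    \<open>j = n\<close>.\<close>
  have cdvd: "P ^ (2 * n - j) dvd c j" if "2 \<le> j" "j \<le> n" for j
    using that
  proof (induction j rule: dec_induct)
    case base
    then show ?case using c2 by simp
  next
    case (step j)
    then have "P ^ (2 * n - j) dvd P * c (Suc j)"
      using c[of j] by (simp add: cong_dvd_iff)
    moreover have "2 * n - j = Suc (2 * n - Suc j)" using step by simp
    ultimately show ?case using cancel by metis
  qed
  \<comment> \<open>Each step gains one factor \<open>P\<close>. The range ends at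
    \<open>n - 1\<close>, since the next arrow is the modified one.\<close>
  have ddvd: "P ^ (j - 2) dvd d j" if "2 \<le> j" "j \<le> n - 1" for j
    using that
  proof (induction j rule: dec_induct)
    case (step j)
    then have "P ^ Suc (j - 2) dvd d j * P" by simp
    moreover have "Suc (j - 2) = j - 1" using step by simp
    ultimately show ?case using d[of j] step by (simp add: cong_dvd_iff)
  qed simp
  have Aeq: "[A 1 = A j] (mod P ^ (n - 1))" if "1 \<le> j" "j \<le> n" for j
    using that
  proof (induction j rule: dec_induct)
    case (step j)
    have "P ^ Suc (n - 1) dvd P * (A j - A (Suc j))"
      using A[of j] step n by (simp add: cong_iff_dvd_diff algebra_simps)
    then have "[A j = A (Suc j)] (mod P ^ (n - 1))"
      unfolding cong_iff_dvd_diff by (rule cancel)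
    with step show ?case using cong_trans by fastforce
  qed simp
  have "P ^ n dvd c n" using cdvd[of n] n by simp
  moreover have "P ^ n dvd b n * (- P) + c n - (- P * A 1)"
    using bot by (simp add: cong_iff_dvd_diff)
  ultimately have "P ^ n dvd b n * (- P) + c n - (- P * A 1) - c n" by (rule dvd_diff[rotated])
  also have "b n * (- P) + c n - (- P * A 1) - c n = P * (A 1 - b n)" by (simp add: algebra_simps)
  finally have "P ^ Suc (n - 1) dvd P * (A 1 - b n)" using n by simp
  then have 1: "P ^ (n - 1) dvd A 1 - b n" by (rule cancel)
  have 2: "P ^ (n - 1) dvd A 1 - A n" using Aeq[of n] n by (simp add: cong_iff_dvd_diff)
  have 3: "P ^ (n - 1) dvd A n - (b n + P * d n)" using top by (simp add: cong_iff_dvd_diff)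
  \<comment> \<open>The alternating sum telescopes to \<open>P * d n\<close>.\<close>
  have "P ^ (n - 1) dvd (A 1 - b n) - (A 1 - A n) - (A n - (b n + P * d n))"
    using dvd_diff[OF dvd_diff[OF 1 2] 3] .
  then have "P ^ Suc (n - 2) dvd P * d n" using n by (simp add: Suc_diff_Suc numeral_2_eq_2)
  then have dn0: "P ^ (n - 2) dvd d n" by (rule cancel)
  have n32: "n - 2 = Suc (n - 3)" using n by simp
  \<comment> \<open>In \<open>dn\<close> both \<open>d n\<close> and \<open>d (n - 1) * P\<close>
    are now divisible by \<open>P ^ (n - 2)\<close>, whereas the modification contributes only
    \<open>P ^ (n - 3)\<close>; the missing factor must divide \<open>e (n - 1)\<close>.\<close>
  have "P ^ Suc (n - 3) dvd d (n - 1) * P" using ddvd[of "n - 1"] n by (simp add: numeral_3_eq_3)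
  moreover have "P ^ (n - 2) dvd d (n - 1) * P + e (n - 1) * P ^ (n - 3)"
    using dn dn0 by (simp add: cong_dvd_iff)
  ultimately have "P ^ Suc (n - 3) dvd e (n - 1) * P ^ (n - 3)"
    unfolding n32 by (simp add: dvd_add_right_iff)
  then have "P dvd e (n - 1)" using P0 by simp
  moreover have "[e (n - 1) = e n] (mod P)"
    using en by (rule cong_dvd_modulus) (simp add: n32)
  ultimately have "P dvd e n" by (simp add: cong_dvd_iff)
  moreover have "[d n * (- P) + e n = A 1] (mod P)"
    using bot' by (rule cong_dvd_modulus) (use n in simp)
  ultimately show ?thesis using cong_dvd_iff by fastforce
qed

text \<open>Naturality of \<open>F\<close> at \<open>u <= v\<close>, read off entrywise;
  \<open>A\<close> is the matrix of the arrow in the target diagram \<open>Y\<close> and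
  \<open>B\<close> that in the source diagram \<open>X\<close>.\<close>

lemma transformation_square_cong:
  assumes p: "p > 1"
    and F: "F \<in> periodic_transformations n (stable_mod p (2 * n)) X Y"
    and u: "u \<in> strip n" and v: "v \<in> strip n" and uv: "point_le u v"
    and ob: "dob X u = K" "dob Y u = K" "dob X v = M" "dob Y v = M"
    and K: "K \<in> Ob (mod_category p (2 * n))" and M: "M \<in> Ob (mod_category p (2 * n))"
    and Y: "darr Y u v = mat_class p (2 * n) K M A" and X: "darr X u v = mat_class p (2 * n) K M B"
    and A: "\<And>r s. r < length K \<Longrightarrow> s < length M \<Longrightarrow> int p ^ (M ! s - K ! r) dvd A ! r ! s"
    and B: "\<And>r s. r < length K \<Longrightarrow> s < length M \<Longrightarrow> int p ^ (M ! s - K ! r) dvd B ! r ! s"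
    and f: "f \<in> F u" "g \<in> F v" and r: "r < length K" and s: "s < length M"
  shows "[(\<Sum>t<length K. mat_of p K f r t * A ! t ! s) =
          (\<Sum>t<length M. B ! r ! t * mat_of p M g t s)] (mod int p ^ min (2 * n - K ! r) (M ! s))"
proof (rule stable_square_mat_class[OF p K M _ _ f A B _ r s])
  show "F u \<in> Hom (stable_mod p (2 * n)) K K" "F v \<in> Hom (stable_mod p (2 * n)) M M"
    using F u v ob by (auto simp: periodic_transformations_def)
  have "Comp (stable_mod p (2 * n)) (dob X u) (dob Y u) (dob Y v) (F u) (darr Y u v) =
      Comp (stable_mod p (2 * n)) (dob X u) (dob X v) (dob Y v) (darr X u v) (F v)"
    using F u v uv unfolding periodic_transformations_def by blast
  then show "Comp (stable_mod p (2 * n)) K K M (F u) (mat_class p (2 * n) K M A) =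
      Comp (stable_mod p (2 * n)) K M M (mat_class p (2 * n) K M B) (F v)"
    by (simp only: ob X Y)
qed

lemma transformation_X_Xt_dvd:
  assumes p: "p > 1" and n: "n \<ge> 3"
    and F: "F \<in> periodic_transformations n (stable_mod p (2 * n)) (X_diag p n) (Xt_diag p n)"
    and f: "f \<in> F ((1, 0), (0, 0))"
  shows "int p dvd mat_of p [n] f 0 0"
proof -
  let ?C = "stable_mod p (2 * n)" and ?E = "mod_category p (2 * n)"
  have obX: "dob (X_diag p n) = ext_ob ?C (base_ob n)" "dob (Xt_diag p n) = ext_ob ?C (base_ob n)"
    by (simp_all add: X_diag_def Xt_diag_def)
  have ob: "ext_ob ?C (base_ob n) ((j, 0), (i, 0)) = base_ob n j i" for i j
    by (simp add: ext_ob_def)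
  have ob0: "ext_ob ?C (base_ob n) ((j, 0), (0, 0)) = [n]" if "1 \<le> j" for j
    using that by (simp add: ob base_ob_def)
  have ob1: "ext_ob ?C (base_ob n) ((j, 0), (1, 0)) = [j - 1, 2 * n - (j - 1)]" if "2 \<le> j" for j
    using that by (simp add: ob base_ob_def)
  have ob': "ext_ob ?C (base_ob n) ((0, 1), (1, 0)) = [n]"
    by (simp add: ext_ob_def base_ob_def stable_mod_simps[OF p] shift_obj_def)
  have Ob0: "[n] \<in> Ob ?E" by simp
  have Ob1: "[j - 1, 2 * n - (j - 1)] \<in> Ob ?E" if "j \<le> n" for j
    using that by auto
  have hom: "F u \<in> Hom ?C (ext_ob ?C (base_ob n) u) (ext_ob ?C (base_ob n) u)" if "u \<in> strip n" for u
    using F that by (auto simp: periodic_transformations_def obX)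
  \<comment> \<open>A representative is fixed at every point once and for all, so that neighbouring
    squares share their entries.\<close>
  have "\<exists>g. u \<in> strip n \<longrightarrow> g \<in> F u" for u
    using stable_hom_nonempty[OF p hom] by blast
  then obtain g where g: "\<And>u. u \<in> strip n \<Longrightarrow> g u \<in> F u" by metis
  define A where "A j = mat_of p [n] (g ((j, 0), (0, 0))) 0 0" for j
  define N where "N j r s = mat_of p [j - 1, 2 * n - (j - 1)] (g ((j, 0), (1, 0))) r s" for j r s
  let ?h = "g ((0, 1), (1, 0))"
  note square = transformation_square_cong[OF p F, unfolded obX]
  have succ: "sym_succ n (j, 0) = (j + 1, 0)" if "j < n" for j
    using that by (simp add: sym_succ_def)
  have succ_n: "sym_succ n (n, 0) = (0, 1)" by (simp add: sym_succ_def)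
  have num0: "darr (X_diag p n) ((j, 0), (0, 0)) ((j + 1, 0), (0, 0)) = mat_class p (2 * n) [n] [n] [[int p]]"
      "darr (Xt_diag p n) ((j, 0), (0, 0)) ((j + 1, 0), (0, 0)) = mat_class p (2 * n) [n] [n] [[int p]]"
    if "1 \<le> j" "j < n" for j
    using that darr_matrix_diagram_num[of 0 j n] ob0 ob[of j 0]
    by (simp_all add: X_diag_def Xt_diag_def succ X_num_def Xt_num_def)
  have den0: "darr (X_diag p n) ((n, 0), (0, 0)) ((n, 0), (1, 0)) =
        mat_class p (2 * n) [n] [n - 1, 2 * n - (n - 1)] [[1, int p]]"
      "darr (Xt_diag p n) ((n, 0), (0, 0)) ((n, 0), (1, 0)) =
        mat_class p (2 * n) [n] [n - 1, 2 * n - (n - 1)] [[1, int p]]"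
    using n darr_matrix_diagram_den[of 0 n n]
    by (simp_all add: X_diag_def Xt_diag_def X_den_def Xt_den_def base_ob_def)
  \<comment> \<open>The lower left entry in \<open>Xt_diag\<close>, which allows the squares along
    \<open>j/1\<close> to be treated uniformly.\<close>
  define w where "w j = (if j = n - 1 then int p ^ (n - 3) else 0)" for j
  have num1: "darr (X_diag p n) ((j, 0), (1, 0)) ((j + 1, 0), (1, 0)) =
        mat_class p (2 * n) [j - 1, 2 * n - (j - 1)] [j, 2 * n - j] [[int p, 0], [0, 1]]"
      "darr (Xt_diag p n) ((j, 0), (1, 0)) ((j + 1, 0), (1, 0)) =
        mat_class p (2 * n) [j - 1, 2 * n - (j - 1)] [j, 2 * n - j]
          [[int p, 0], [w j, 1]]"
    if "2 \<le> j" "j < n" for j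
    using that darr_matrix_diagram_num[of 1 j n] ob1[of "j + 1"] ob1[of j] ob[of j 1]
    by (simp_all add: X_diag_def Xt_diag_def succ X_num_def Xt_num_def w_def)
  have n_neq: "n \<noteq> n - 1" using n by simp
  have num': "darr (X_diag p n) ((n, 0), (1, 0)) ((0, 1), (1, 0)) =
        mat_class p (2 * n) [n - 1, 2 * n - (n - 1)] [n] [[- int p], [1]]"
      "darr (Xt_diag p n) ((n, 0), (1, 0)) ((0, 1), (1, 0)) =
        mat_class p (2 * n) [n - 1, 2 * n - (n - 1)] [n] [[- int p], [1]]"
    using n n_neq darr_matrix_diagram_num[of 1 n n] ob1[of n] ob[of n 1] ob'
    by (simp_all add: X_diag_def Xt_diag_def succ_n X_num_def Xt_num_def)
  have "int p dvd A 1"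
  proof (rule p_dvd_endomorphism[where b = "\<lambda>j. N j 0 0" and c = "\<lambda>j. N j 0 1"
        and d = "\<lambda>j. N j 1 0" and e = "\<lambda>j. N j 1 1", OF _ n])
    show "int p > 1" using p by simp
    show "[A j * int p = int p * A (j + 1)] (mod int p ^ n)" if "1 \<le> j" "j < n" for j
      using square[of "((j, 0), (0, 0))" "((j + 1, 0), (0, 0))" "[n]" "[n]" "[[int p]]" "[[int p]]"
          "g ((j, 0), (0, 0))" "g ((j + 1, 0), (0, 0))" 0 0] num0[of j] that
      by (simp add: ob0 strip_base g A_def point_le_def sym_le_def)
    have dv0: "int p ^ ([n - 1, 2 * n - (n - 1)] ! s - [n] ! r) dvd [[1, int p]] ! r ! s"
      if "r < length [n]" "s < length [n - 1, 2 * n - (n - 1)]" for r s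
      using that n by (auto simp: less_Suc_eq)
    show "[A n = N n 0 0 + int p * N n 1 0] (mod int p ^ (n - 1))"
      using square[of "((n, 0), (0, 0))" "((n, 0), (1, 0))" "[n]" "[n - 1, 2 * n - (n - 1)]"
          "[[1, int p]]" "[[1, int p]]" "g ((n, 0), (0, 0))" "g ((n, 0), (1, 0))" 0 0,
          OF _ _ _ _ _ _ _ Ob0 Ob1[of n] den0(2,1) dv0 dv0] n ob0[of n] ob1[of n]
      by (simp add: strip_base g A_def N_def point_le_def sym_le_def numeral_2_eq_2)
    have dv: "int p ^ ([j, 2 * n - j] ! s - [j - 1, 2 * n - (j - 1)] ! r) dvd [[int p, 0], [a, 1]] ! r ! s"
      if "2 \<le> j" "j < n" "r < length [j - 1, 2 * n - (j - 1)]" "s < length [j, 2 * n - j]" for j r s a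
      using that by (auto simp: less_Suc_eq)
    \<comment> \<open>All four entries of one square; the cases \<open>(0, 1)\<close>,
      \<open>(1, 0)\<close> and \<open>(1, 1)\<close> yield the congruences for \<open>c\<close>,
      \<open>d\<close> and \<open>e\<close>.\<close>
    have sq1: "[N j r 0 * [[int p, 0], [w j, 1]] ! 0 ! s + N j r 1 * [[int p, 0], [w j, 1]] ! 1 ! s =
        [[int p, 0], [0, 1]] ! r ! 0 * N (j + 1) 0 s + [[int p, 0], [0, 1]] ! r ! 1 * N (j + 1) 1 s]
        (mod int p ^ min (2 * n - [j - 1, 2 * n - (j - 1)] ! r) ([j, 2 * n - j] ! s))"
      if j: "2 \<le> j" "j < n" and rs: "r < 2" "s < 2" for j r s
    proof -
      have Ob: "[j, 2 * n - j] \<in> Ob ?E" using j by auto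
      show ?thesis
        using square[of "((j, 0), (1, 0))" "((j + 1, 0), (1, 0))" "[j - 1, 2 * n - (j - 1)]" "[j, 2 * n - j]",
            OF _ _ _ _ _ _ _ Ob1[of j] Ob num1(2)[OF j] num1(1)[OF j] dv[OF j] dv[OF j]
            g[of "((j, 0), (1, 0))"] g[of "((j + 1, 0), (1, 0))"], of r s]
          j rs ob1[of j] ob1[of "j + 1"]
        by (simp add: strip_base N_def point_le_def sym_le_def numeral_2_eq_2)
    qed
    show "[N j 0 1 = int p * N (j + 1) 0 1] (mod int p ^ (2 * n - j))" if "2 \<le> j" "j < n" for j
      using sq1[OF that, of 0 1] that by (simp add: numeral_2_eq_2)
    show "[N j 1 0 * int p = N (j + 1) 1 0] (mod int p ^ (j - 1))" if "2 \<le> j" "j < n - 1" for j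
      using sq1[of j 1 0] that by (simp add: w_def numeral_2_eq_2)
    show "[N (n - 1) 1 0 * int p + N (n - 1) 1 1 * int p ^ (n - 3) = N n 1 0] (mod int p ^ (n - 2))"
      using sq1[of "n - 1" 1 0] n by (simp add: w_def numeral_2_eq_2)
    show "[N (n - 1) 1 1 = N n 1 1] (mod int p ^ (n - 2))"
      using sq1[of "n - 1" 1 1] n by (simp add: w_def numeral_2_eq_2)
    \<comment> \<open>At \<open>2/1\<close> the first summand has exponent \<open>1\<close>, so its
      component into the summand of exponent \<open>2 * n - 1\<close> is divisible by
      \<open>p ^ (2 * n - 2)\<close>.\<close>
    have "g ((2, 0), (1, 0)) \<in> Hom ?E [1, 2 * n - 1] [1, 2 * n - 1]"
      using stable_hom_memD[OF p hom g, of "((2, 0), (1, 0))"] n ob1[of 2] strip_base[of 1 2 n] by simp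
    from mat_of_dvd[OF p this, of 0 1] show "int p ^ (2 * n - 2) dvd N 2 0 1"
      using n by (simp add: N_def numeral_2_eq_2)
    \<comment> \<open>The point \<open>((0, 1), (1, 0))\<close> is the shift of \<open>1/0\<close>;
      this is where periodicity of the morphism enters.\<close>
    have AA: "[mat_of p [n] ?h 0 0 = A 1] (mod int p ^ n)"
    proof -
      have "((1, 0), (0, 0)) \<in> strip n" using n by (simp add: strip_base)
      moreover have "?h \<in> F (point_shift ((1, 0), (0, 0)))"
        using g[OF strip_wrap[of 1 n]] n by (simp add: point_shift_def sym_shift_def)
      ultimately have "?h \<in> Sh_mor ?C [n] [n] (F ((1, 0), (0, 0)))"
        using F ob0[of 1] by (simp add: periodic_transformations_def obX)
      then show ?thesis
        unfolding A_def using mat_of_shift_map[OF p] hom[of "((1, 0), (0, 0))"] g n ob0[of 1]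
        by (simp add: strip_base)
    qed
    have dv': "int p ^ ([n] ! s - [n - 1, 2 * n - (n - 1)] ! r) dvd [[- int p], [1]] ! r ! s"
      if "r < length [n - 1, 2 * n - (n - 1)]" "s < length [n]" for r s
      using that n by (auto simp: less_Suc_eq)
    \<comment> \<open>Row \<open>0\<close> has modulus \<open>p ^ n\<close>, row \<open>1\<close>
      only \<open>p ^ (n - 1)\<close>.\<close>
    have bot: "[N n r 0 * (- int p) + N n r 1 = [[- int p], [1]] ! r ! 0 * mat_of p [n] ?h 0 0]
        (mod int p ^ min (2 * n - [n - 1, 2 * n - (n - 1)] ! r) n)" if "r < 2" for r
      using square[of "((n, 0), (1, 0))" "((0, 1), (1, 0))" "[n - 1, 2 * n - (n - 1)]" "[n]",
          OF _ _ _ _ _ _ _ Ob1[of n] Ob0 num'(2,1) dv' dv' g[of "((n, 0), (1, 0))"] g[of "((0, 1), (1, 0))"],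
          of r 0] n that ob1[of n] ob'
      by (simp add: strip_base strip_wrap N_def point_le_def sym_le_def numeral_2_eq_2)
    have "[N n 0 0 * (- int p) + N n 0 1 = - int p * mat_of p [n] ?h 0 0] (mod int p ^ n)"
      using bot[of 0] n by simp
    also have "[- int p * mat_of p [n] ?h 0 0 = - int p * A 1] (mod int p ^ n)"
      using AA by (rule cong_scalar_left)
    finally show "[N n 0 0 * (- int p) + N n 0 1 = - int p * A 1] (mod int p ^ n)" .
    have "[N n 1 0 * (- int p) + N n 1 1 = mat_of p [n] ?h 0 0] (mod int p ^ (n - 1))"
      using bot[of 1] n by simp
    also have "[mat_of p [n] ?h 0 0 = A 1] (mod int p ^ (n - 1))"
      using AA by (rule cong_dvd_modulus) (simp add: le_imp_power_dvd)
    finally show "[N n 1 0 * (- int p) + N n 1 1 = A 1] (mod int p ^ (n - 1))" .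
  qed
  \<comment> \<open>The given \<open>f\<close> and the chosen representative lie in the same class,
    so their entries agree modulo \<open>p ^ n\<close>.\<close>
  moreover have "[mat_of p [n] f 0 0 = A 1] (mod int p ^ n)"
    using stable_hom_cong[OF p Ob0 Ob0 _ f g, of 0 0] hom[of "((1, 0), (0, 0))"] n ob0[of 1] strip_base[of 0 1 n]
    by (simp add: A_def)
  then have "[mat_of p [n] f 0 0 = A 1] (mod int p)"
    by (rule cong_dvd_modulus) (use n in simp)
  ultimately show ?thesis by (simp add: cong_dvd_iff)
qed

theorem lemma2p2:
  fixes p n :: nat
  assumes "prime p" and "n \<ge> 3"
  shows "\<not> isomorphic (periodic_pretriangles n (stable_mod p (2 * n))) (X_diag p n) (Xt_diag p n)"
proof
  let ?C = "stable_mod p (2 * n)" and ?E = "mod_category p (2 * n)" and ?u = "((1, 0), (0, 0)) :: point"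
  have p: "p > 1" using assms(1) by (rule prime_gt_1_nat)
  assume "isomorphic (periodic_pretriangles n ?C) (X_diag p n) (Xt_diag p n)"
  then obtain F G where F: "F \<in> periodic_transformations n ?C (X_diag p n) (Xt_diag p n)"
    and G: "G \<in> periodic_transformations n ?C (Xt_diag p n) (X_diag p n)"
    and FG: "(\<lambda>u\<in>strip n. Comp ?C (dob (X_diag p n) u) (dob (Xt_diag p n) u) (dob (X_diag p n) u) (F u) (G u)) =
      (\<lambda>u\<in>strip n. Id ?C (dob (X_diag p n) u))"
    by (auto simp: isomorphic_def periodic_pretriangles_def)
  have u: "?u \<in> strip n" using assms(2) by (simp add: strip_base)
  have ob: "dob (X_diag p n) ?u = [n]" "dob (Xt_diag p n) ?u = [n]"
    by (simp_all add: X_diag_def Xt_diag_def ext_ob_def base_ob_def)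
  have Ob: "[n] \<in> Ob ?E" by simp
  have Fu: "F ?u \<in> Hom ?C [n] [n]" and Gu: "G ?u \<in> Hom ?C [n] [n]"
    using F G u ob by (auto simp: periodic_transformations_def)
  have eq: "Comp ?C [n] [n] [n] (F ?u) (G ?u) = Id ?C [n]"
    using fun_cong[OF FG, of ?u] u ob by simp
  obtain f g where f: "f \<in> F ?u" and g: "g \<in> G ?u"
    using stable_hom_nonempty[OF p Fu] stable_hom_nonempty[OF p Gu] by blast
  \<comment> \<open>The identity represents the composite at \<open>1/0\<close>, so its entry
    \<open>1\<close> is congruent to the product of the entries of \<open>f\<close> and
    \<open>g\<close>, the first of which is divisible by \<open>p\<close>.\<close>
  have "Id ?E [n] \<in> Hom ?E [n] [n]"
    by (simp add: linear_maps_def cyc_sum_add_closed[OF p] cyc_sum_smult_closed[OF p])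
  from stable_eq_refl[OF p this] have "Id ?E [n] \<in> Comp ?C [n] [n] [n] (F ?u) (G ?u)"
    unfolding eq unfolding stable_mod_simps(3)[OF p] by blast
  from stable_comp_cong[OF p Ob Ob Ob Fu Gu f g this, of 0 0]
  have "[mat_of p [n] (Id ?E [n]) 0 0 = mat_of p [n] f 0 0 * mat_of p [n] g 0 0] (mod int p ^ n)"
    by simp
  moreover have "mat_of p [n] (Id ?E [n]) 0 0 = 1"
    using unit_elt_closed[OF p, of "[n]" 0] one_less_power[of "int p" n] p assms(2)
    by (simp add: mat_of_def unit_elt_def)
  ultimately have "[1 = mat_of p [n] f 0 0 * mat_of p [n] g 0 0] (mod int p ^ n)"
    by simp
  then have "[1 = mat_of p [n] f 0 0 * mat_of p [n] g 0 0] (mod int p)"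
    by (rule cong_dvd_modulus) (use assms(2) in simp)
  then have "int p dvd 1"
    using transformation_X_Xt_dvd[OF p assms(2) F f] by (metis cong_dvd_iff dvd_mult2)
  then show False using p by simp
qed

end
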